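(* Assume the losses are bounded, $\ell_t^{(k)}\in[0,1]$ almost surely for all $k\in[K]$ and $t\ge 1$, that $\Delta>0$, and that almost surely there are no ties in the FTL weights, i.e. $|\mathrm{FTL}_t|=1$ for all $t\ge 1$. Let $v_{\max}:=\max_{k\in[K]}v_k$. Then for every $T\ge 1$, $$\mathbb E\big[\overline R_{\mathrm{FTL},T}\big]\le \min\{R^H_{\mathrm{FTL}},R^B_{\mathrm{FTL}}\},$$ where: (i) if for every $k\in[K]$ the sequence $(\ell^{(k)}_t)_{t\ge1}$ is i.i.d., then $$R^H_{\mathrm{FTL}}=2+\frac{2\log K+4}{\Delta^2},\qquad R^B_{\mathrm{FTL}}=2+\frac{(8v_{\max}+\tfrac43\Delta)(\log(2K)+2)}{\Delta^2};$$ (ii) if for every $k\in[K]$ the sequence $(\ell^{(k)}_t)_{t}$ is strictly stationary and $\varphi$-mixing with coefficients $(\varphi^{(k)}_n)_{n\ge1}$, and there is a finite constant $C_{2,\varphi}$ with $\max_{k\in[K]}\sum_{n=1}^\infty\sqrt{\varphi^{(k)}_n}<C_{2,\varphi}$, then $$R^H_{\mathrm{FTL}}=3+\frac{8\,\overline\theta^{H}_{\max}(\log K+4)}{\Delta^2},\qquad \overline\theta^{H}_{\max}=\max_{k\in[K]}\sup_{t\ge1}\Big(1+4\sum_{n=1}^{t-1}\varphi^{(k)}_n\Big),$$ $$R^B_{\mathrm{FTL}}=2+\frac{8\,\overline\theta^{B}_{\max}(8v_{\max}+\Delta)(\log K+2)}{\Delta^2},\qquad \overline\theta^{B}_{\max}=\max_{k\in[K]}\sup_{t\ge1}\Big(1+\sum_{n=1}^{t}\sqrt{\varphi^{(k)}_n}\Big)^2.$$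 In particular these bounds do not depend on $T$.
   Context: There are $K\ge1$ experts indexed by $k\in[K]=\{1,\dots,K\}$. For each round $t=1,2,\dots$ there is a random loss vector $\boldsymbol\ell_t=(\ell_t^{(1)},\dots,\ell_t^{(K)})^\top$; no independence across experts is assumed. Cumulative losses are $L^{(k)}_t=\sum_{s=1}^t\ell^{(k)}_s$ with $L^{(k)}_0=0$. Under the stated dependence assumptions the means $\mu_k=\mathbb E[\ell^{(k)}_t]$ and variances $v_k=\mathrm{Var}(\ell^{(k)}_t)$ do not depend on $t$. Let $k^\star\in\arg\min_{k}\mu_k$, $\Delta_k=\mu_k-\mu_{k^\star}$ and $\Delta=\min_{k\neq k^\star}\Delta_k$ (sub-optimality gap). A forecaster uses weights $\boldsymbol\omega_t\in\{\omega\in\mathbb R^K_{\ge0}:\sum_k\omega_k=1\}$ chosen from information up to round $t-1$ and incurs loss $\overline\ell_t=\boldsymbol\omega_t^\top\boldsymbol\ell_t$; its regret is $\overline R_T=\sum_{t=1}^T\overline\ell_t-\min_{k\in[K]}L^{(k)}_T$. Follow-the-Leader (FTL): $\mathrm{FTL}_t=\arg\min_{k\in[K]}L^{(k)}_{t-1}$ and $\omega^{(k)}_{\mathrm{FTL},t}=\mathbf 1\{k\in\mathrm{FTL}_t\}/|\mathrm{FTL}_t|$ (uniform at $t=1$); $\overline R_{\mathrm{FTL},T}$ is the regret of these weights. $\varphi$-mixing: for a (real or vector valued) sequence $(U_i)_{i\in\mathbb Z}$, with $\mathcal F_m=\sigma(U_i:i\le m)$ and $\varphi(\mathcal A,\mathcal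 B)=\sup\{|\mathbb P(B\mid A)-\mathbb P(B)|:A\in\mathcal A,\mathbb P(A)>0,B\in\mathcal B\}$, the coefficients are $\varphi_n=\sup_{m}\varphi(\mathcal F_m,\sigma(U_{m+n}))$, $n\ge1$; the sequence is $\varphi$-mixing if $\varphi_n\to0$.
   Formalization: The no-ties assumption is required only for t ≥ 2, since at t = 1 all cumulative losses are 0 and FTL_1 = [K], so it cannot hold at t = 1 when K ≥ 2; and K ≥ 2 is assumed, since for K = 1 the gap Δ is a minimum over an empty set. *)

theory Defs
  imports "HOL-Probability.Probability"
begin

text \<open>Losses: X t k w is the loss of expert k (k < K) at round t (t >= 1).\<close>

definition cumloss :: "(nat \<Rightarrow> nat \<Rightarrow> 'a \<Rightarrow> real) \<Rightarrow> nat \<Rightarrow> nat \<Rightarrow> 'a \<Rightarrow> real" where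
  "cumloss X t k w = (\<Sum>s\<in>{1..t}. X s k w)"

definition ftl_set :: "nat \<Rightarrow> (nat \<Rightarrow> nat \<Rightarrow> 'a \<Rightarrow> real) \<Rightarrow> nat \<Rightarrow> 'a \<Rightarrow> nat set" where
  "ftl_set K X t w = {k \<in> {..<K}. \<forall>j\<in>{..<K}. cumloss X (t - 1) k w \<le> cumloss X (t - 1) j w}"

definition ftl_weight :: "nat \<Rightarrow> (nat \<Rightarrow> nat \<Rightarrow> 'a \<Rightarrow> real) \<Rightarrow> nat \<Rightarrow> nat \<Rightarrow> 'a \<Rightarrow> real" where
  "ftl_weight K X t k w =
     (if k \<in> ftl_set K X t w then 1 / real (card (ftl_set K X t w)) else 0)"

definition ftl_regret :: "nat \<Rightarrow> (nat \<Rightarrow> nat \<Rightarrow> 'a \<Rightarrow> real) \<Rightarrow> nat \<Rightarrow> 'a \<Rightarrow> real" where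
  "ftl_regret K X T w =
     (\<Sum>t\<in>{1..T}. \<Sum>k<K. ftl_weight K X t k w * X t k w)
     - Min ((\<lambda>k. cumloss X T k w) ` {..<K})"

definition loss_mean :: "'a measure \<Rightarrow> (nat \<Rightarrow> nat \<Rightarrow> 'a \<Rightarrow> real) \<Rightarrow> nat \<Rightarrow> real" where
  "loss_mean M X k = integral\<^sup>L M (X 1 k)"

definition loss_var :: "'a measure \<Rightarrow> (nat \<Rightarrow> nat \<Rightarrow> 'a \<Rightarrow> real) \<Rightarrow> nat \<Rightarrow> real" where
  "loss_var M X k = integral\<^sup>L M (\<lambda>w. (X 1 k w - loss_mean M X k)\<^sup>2)"

definition gap :: "'a measure \<Rightarrow> (nat \<Rightarrow> nat \<Rightarrow> 'a \<Rightarrow> real) \<Rightarrow> nat \<Rightarrow> nat \<Rightarrow> real" where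
  "gap M X K kstar = Min ((\<lambda>k. loss_mean M X k - loss_mean M X kstar) ` ({..<K} - {kstar}))"

definition vmax :: "'a measure \<Rightarrow> (nat \<Rightarrow> nat \<Rightarrow> 'a \<Rightarrow> real) \<Rightarrow> nat \<Rightarrow> real" where
  "vmax M X K = Max ((\<lambda>k. loss_var M X k) ` {..<K})"

definition iid_seq :: "'a measure \<Rightarrow> (nat \<Rightarrow> 'a \<Rightarrow> real) \<Rightarrow> bool" where
  "iid_seq M U \<longleftrightarrow> prob_space.indep_vars M (\<lambda>_. (borel :: real measure)) U {1..}
     \<and> (\<forall>t\<ge>1. distr M borel (U t) = distr M (borel :: real measure) (U 1))"

definition strictly_stationary :: "'a measure \<Rightarrow> (nat \<Rightarrow> 'a \<Rightarrow> real) \<Rightarrow> bool" where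
  "strictly_stationary M U \<longleftrightarrow> (\<forall>n t. 1 \<le> t \<longrightarrow>
     distr M (Pi\<^sub>M {..<n} (\<lambda>_. (borel :: real measure))) (\<lambda>w. \<lambda>i\<in>{..<n}. U (t + i) w)
     = distr M (Pi\<^sub>M {..<n} (\<lambda>_. (borel :: real measure))) (\<lambda>w. \<lambda>i\<in>{..<n}. U (1 + i) w))"

definition past_sigma :: "'a measure \<Rightarrow> (nat \<Rightarrow> 'a \<Rightarrow> real) \<Rightarrow> nat \<Rightarrow> 'a set set" where
  "past_sigma M U m = sigma_sets (space M)
     (\<Union>i\<in>{1..m}. {U i -` B \<inter> space M | B. B \<in> sets (borel :: real measure)})"

definition single_sigma :: "'a measure \<Rightarrow> (nat \<Rightarrow> 'a \<Rightarrow> real) \<Rightarrow> nat \<Rightarrow> 'a set set" where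
  "single_sigma M U t = {U t -` B \<inter> space M | B. B \<in> sets (borel :: real measure)}"

definition phi_mix_coeff :: "'a measure \<Rightarrow> (nat \<Rightarrow> 'a \<Rightarrow> real) \<Rightarrow> nat \<Rightarrow> real" where
  "phi_mix_coeff M U n = Sup {\<bar>measure M (A \<inter> B) / measure M A - measure M B\<bar> | m A B.
      1 \<le> m \<and> A \<in> past_sigma M U m \<and> measure M A > 0 \<and> B \<in> single_sigma M U (m + n)}"

definition phi_mixing :: "'a measure \<Rightarrow> (nat \<Rightarrow> 'a \<Rightarrow> real) \<Rightarrow> bool" where
  "phi_mixing M U \<longleftrightarrow> (\<lambda>n. phi_mix_coeff M U n) \<longlonglongrightarrow> 0"

definition thetaH_max :: "'a measure \<Rightarrow> (nat \<Rightarrow> nat \<Rightarrow> 'a \<Rightarrow> real) \<Rightarrow> nat \<Rightarrow> real" where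
  "thetaH_max M X K = Max ((\<lambda>k. SUP t\<in>{1..}.
      1 + 4 * (\<Sum>n\<in>{1..<t}. phi_mix_coeff M (\<lambda>s. X s k) n)) ` {..<K})"

definition thetaB_max :: "'a measure \<Rightarrow> (nat \<Rightarrow> nat \<Rightarrow> 'a \<Rightarrow> real) \<Rightarrow> nat \<Rightarrow> real" where
  "thetaB_max M X K = Max ((\<lambda>k. SUP t\<in>{1..}.
      (1 + (\<Sum>n\<in>{1..t}. sqrt (phi_mix_coeff M (\<lambda>s. X s k) n)))\<^sup>2) ` {..<K})"

end

(*
On bounded losses the regret of follow-the-leader is at most 2 plus the number of rounds t in
which kstar is not the leader: once kstar leads, only the loss difference to kstar in the rounds
where it does not lead matters, and one final excursion away from kstar costs at most one more
unit.  The leader after round t can differ from kstar only if some centred cumulative loss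
deviates by t times half the gap, so a tail bound exp (- c t) for each single expert gives
E R <= 2 + (ln K + 2) / c.

For independent losses the tail bounds are those of Hoeffding and Bernstein.  Under phi-mixing
let S j be the sum of the first j centred losses.  The moment generating function E exp (l S j)
is controlled by induction on j: exp (l S (j-1)) is expanded as a telescoping sum of increments
exp (l S i) - exp (l S (i-1)), and each increment is decoupled from the j-th loss by a covariance
inequality with phi (j-i).  The Hoeffding form uses the range of the j-th loss.  The Bernstein
form uses a pointwise conditional L2 bound with sqrt (phi (j-i)), and carries the tilted second
moments E [exp (l S j) V n ^ 2] along in the induction.  Only the coefficients between the past
and a single future loss are needed.
*)
theory Submission
  imports Defs
begin

section \<open>Covariance inequalities under mixing\<close>

text \<open>The mixing condition is one-sided: an event \<open>A\<close> of the past enters with the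
  weight P(A). Hence it controls the conditional expectation of a future variable almost surely, and
  covariances are bounded by the L1 norm of the past factor, not by its supremum. This is what lets
  an induction close: the past factors have the size of \<open>exp (l S i)\<close>, whose supremum
  grows exponentially, while their means are the quantities under induction. Taken as a whole,
  \<open>exp (l S (j-1))\<close> has only gap 1 to the \<open>j\<close>-th loss, so its covariance
  would carry \<phi> 1 and no factor l from the past. An increment is of order l, and its gap grows
  with its age. Together with the factor l of the future variable the total error is l^2 times a sum
  of coefficients, which is the order of the exponent itself. For Bernstein the error must also be
  proportional to the variance, which a range estimate does not give. Young's inequality with a free
  scale turns the product of a past and a future loss into squares weighted by
  \<open>exp (l S (i-1))\<close>, and these are again of order v.\<close>

locale mixing_pair = prob_space +
  fixes F G :: "'a measure" and p :: real
  assumes F: "subalgebra M F" and G: "subalgebra M G" and p_nonneg: "0 \<le> p"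
    and dep: "\<And>A B. A \<in> sets F \<Longrightarrow> B \<in> sets G \<Longrightarrow>
      \<bar>prob (A \<inter> B) - prob A * prob B\<bar> \<le> p * prob A"
begin

sublocale F: finite_measure_subalgebra M F
  by unfold_locales (rule F)

sublocale G: finite_measure_subalgebra M G
  by unfold_locales (rule G)

lemma sets_F: "A \<in> sets F \<Longrightarrow> A \<in> sets M" and sets_G: "A \<in> sets G \<Longrightarrow> A \<in> sets M"
  using F G by (auto simp: subalgebra_def)

lemma bounded_integrable:
  fixes f :: "'a \<Rightarrow> real"
  assumes "f \<in> borel_measurable M" "\<And>x. \<bar>f x\<bar> \<le> C"
  shows "integrable M f"
  using assms by (intro integrable_const_bound[where B=C]) auto

lemma bounded_mult_integrable:
  fixes f g :: "'a \<Rightarrow> real"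
  assumes "f \<in> borel_measurable M" "\<And>x. \<bar>f x\<bar> \<le> C" "integrable M g"
  shows "integrable M (\<lambda>x. f x * g x)"
proof (rule Bochner_Integration.integrable_bound[where f="\<lambda>x. C * g x"])
  show "(\<lambda>x. f x * g x) \<in> borel_measurable M" using assms(1,3) by auto
  have "\<bar>f x\<bar> \<le> \<bar>C\<bar>" for x using assms(2)[of x] by linarith
  then show "AE x in M. norm (f x * g x) \<le> norm (C * g x)"
    by (auto simp: abs_mult intro!: mult_right_mono)
qed (use assms(3) in auto)

text \<open>The signed measure \<open>B \<mapsto> P(A \<inter> B) - P(A) P(B)\<close> on \<open>G\<close> has a density \<open>W\<close>; evaluating it on
  \<open>B = {W > 0}\<close> turns the mixing bound into an \<open>L\<^sup>1\<close> bound on \<open>W\<close>.\<close>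

lemma covariance_density:
  assumes A: "A \<in> sets F"
  obtains W where "W \<in> borel_measurable G" "integrable M W" "(\<integral>x. \<bar>W x\<bar> \<partial>M) \<le> 2 * p * prob A"
    "\<And>f C. f \<in> borel_measurable G \<Longrightarrow> (\<And>x. \<bar>f x\<bar> \<le> C) \<Longrightarrow>
      integrable M (\<lambda>x. W x * f x) \<and>
      (\<integral>x. W x * f x \<partial>M) = (\<integral>x. indicator A x * f x \<partial>M) - prob A * (\<integral>x. f x \<partial>M)"
    "\<And>f C. f \<in> borel_measurable G \<Longrightarrow> (\<And>x. 0 \<le> f x) \<Longrightarrow> (\<And>x. \<bar>f x\<bar> \<le> C) \<Longrightarrow>
      integrable M (\<lambda>x. \<bar>W x\<bar> * f x) \<and>
      (\<integral>x. \<bar>W x\<bar> * f x \<partial>M) \<le> (\<integral>x. indicator A x * f x \<partial>M) + prob A * (\<integral>x. f x \<partial>M)"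
proof -
  note [measurable] = sets_F[OF A]
  define Y where "Y = real_cond_exp M G (indicator A)"
  define W where "W x = Y x - prob A" for x
  have Ym[measurable]: "Y \<in> borel_measurable G" by (simp add: Y_def)
  have Wm[measurable]: "W \<in> borel_measurable G" unfolding W_def by measurable
  have Y0: "AE x in M. 0 \<le> Y x" unfolding Y_def by (rule G.real_cond_exp_pos) auto
  have Wf: "integrable M (\<lambda>x. Y x * f x) \<and> integrable M (\<lambda>x. f x) \<and> integrable M (\<lambda>x. W x * f x) \<and>
      (\<integral>x. Y x * f x \<partial>M) = (\<integral>x. indicator A x * f x \<partial>M) \<and>
      (\<integral>x. W x * f x \<partial>M) = (\<integral>x. indicator A x * f x \<partial>M) - prob A * (\<integral>x. f x \<partial>M)"
    if f: "f \<in> borel_measurable G" and bd: "\<And>x. \<bar>f x\<bar> \<le> C" for f C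
  proof -
    have fM[measurable]: "f \<in> borel_measurable M" using measurable_from_subalg[OF G f] .
    have 1: "integrable M (\<lambda>x. f x * indicator A x)"
    proof (rule bounded_integrable[where C="\<bar>C\<bar>"])
      fix x show "\<bar>f x * indicator A x\<bar> \<le> \<bar>C\<bar>" using bd[of x] by (auto simp: indicator_def)
    qed simp
    have i2: "integrable M f" using bd by (rule bounded_integrable[OF fM])
    have i1: "integrable M (\<lambda>x. f x * Y x)" and e: "(\<integral>x. f x * Y x \<partial>M) = (\<integral>x. f x * indicator A x \<partial>M)"
      using G.real_cond_exp_intg[OF 1 f] by (auto simp: Y_def)
    have "(\<lambda>x. W x * f x) = (\<lambda>x. f x * Y x - prob A * f x)" by (auto simp: W_def algebra_simps)
    then show ?thesis using i1 i2 e by (simp add: mult.commute)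
  qed
  have Wi: "integrable M W" using Wf[of "\<lambda>_. 1" 1] by simp
  define B where "B = {x\<in>space G. 0 < W x}"
  have B: "B \<in> sets G" unfolding B_def by measurable
  have spG: "space G = space M" using G by (simp add: subalgebra_def)
  have W0: "(\<integral>x. W x \<partial>M) = 0" using Wf[of "\<lambda>_. 1" 1] sets_F[OF A] by (simp add: prob_space)
  have WB: "integrable M (\<lambda>x. W x * indicator B x)"
    "(\<integral>x. W x * indicator B x \<partial>M) = (\<integral>x. indicator A x * indicator B x \<partial>M) - prob A * (\<integral>x. indicator B x \<partial>M)"
    using Wf[of "indicator B" 1] B by (auto simp: indicator_def)
  \<comment> \<open>Since \<open>W\<close> has mean 0, its L1 norm is twice the integral of its
    positive part; hence the factor 2 in the bound.\<close>
  have "(\<integral>x. \<bar>W x\<bar> \<partial>M) = (\<integral>x. 2 * (W x * indicator B x) - W x \<partial>M)"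
    by (rule Bochner_Integration.integral_cong) (auto simp: B_def spG indicator_def)
  also have "\<dots> = 2 * (\<integral>x. W x * indicator B x \<partial>M)"
    using WB Wi W0 by simp
  also have "\<dots> = 2 * (prob (A \<inter> B) - prob A * prob B)"
    using WB(2) sets_F[OF A] sets_G[OF B] by (simp add: indicator_inter_arith[symmetric])
  also have "\<dots> \<le> 2 * p * prob A" using dep[OF A B] by (simp add: abs_le_iff)
  finally have 3: "(\<integral>x. \<bar>W x\<bar> \<partial>M) \<le> 2 * p * prob A" .
  show ?thesis
  proof (rule that[OF Wm Wi 3])
    fix f :: "'a \<Rightarrow> real" and C assume f: "f \<in> borel_measurable G" and bd: "\<And>x. \<bar>f x\<bar> \<le> C"
    show "integrable M (\<lambda>x. W x * f x) \<and>
      (\<integral>x. W x * f x \<partial>M) = (\<integral>x. indicator A x * f x \<partial>M) - prob A * (\<integral>x. f x \<partial>M)"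
      using Wf[OF f bd] by simp
    assume f0: "\<And>x. 0 \<le> f x"
    have i: "integrable M (\<lambda>x. \<bar>W x\<bar> * f x)"
      using integrable_abs[of M "\<lambda>x. W x * f x"] Wf[OF f bd] f0 by (simp add: abs_mult)
    have i3: "integrable M (\<lambda>x. Y x * f x + prob A * f x)" using Wf[OF f bd] by simp
    have "(\<integral>x. \<bar>W x\<bar> * f x \<partial>M) \<le> (\<integral>x. Y x * f x + prob A * f x \<partial>M)"
    proof (rule integral_mono_AE[OF i i3])
      show "AE x in M. \<bar>W x\<bar> * f x \<le> Y x * f x + prob A * f x"
        using Y0
      proof eventually_elim
        case (elim x)
        have "\<bar>W x\<bar> \<le> Y x + prob A" using elim measure_nonneg[of M A] unfolding W_def by linarith
        then have "\<bar>W x\<bar> * f x \<le> (Y x + prob A) * f x" using f0[of x] by (rule mult_right_mono)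
        then show ?case by (simp add: distrib_right)
      qed
    qed
    also have "\<dots> = (\<integral>x. indicator A x * f x \<partial>M) + prob A * (\<integral>x. f x \<partial>M)"
      using Wf[OF f bd] by simp
    finally show "integrable M (\<lambda>x. \<bar>W x\<bar> * f x) \<and>
      (\<integral>x. \<bar>W x\<bar> * f x \<partial>M) \<le> (\<integral>x. indicator A x * f x \<partial>M) + prob A * (\<integral>x. f x \<partial>M)" using i by simp
  qed
qed

text \<open>The density \<open>W\<close> integrates to 0, so \<open>f\<close> may be recentred at
  the midpoint of its range. Half the length against the L1 bound 2 p P(A) yields the full length
  without a further factor 2.\<close>

lemma set_covariance_range:
  assumes A: "A \<in> sets F" and f: "f \<in> borel_measurable G" and r: "\<And>x. a \<le> f x" "\<And>x. f x \<le> b"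
  shows "\<bar>(\<integral>x. indicator A x * f x \<partial>M) - prob A * (\<integral>x. f x \<partial>M)\<bar> \<le> p * (b - a) * prob A"
proof -
  obtain W where W: "W \<in> borel_measurable G" "integrable M W" "(\<integral>x. \<bar>W x\<bar> \<partial>M) \<le> 2 * p * prob A"
    "\<And>f C. f \<in> borel_measurable G \<Longrightarrow> (\<And>x. \<bar>f x\<bar> \<le> C) \<Longrightarrow>
      integrable M (\<lambda>x. W x * f x) \<and>
      (\<integral>x. W x * f x \<partial>M) = (\<integral>x. indicator A x * f x \<partial>M) - prob A * (\<integral>x. f x \<partial>M)"
    by (rule covariance_density[OF A]) blast
  have ab: "a \<le> b" using r[of undefined] by linarith
  define c where "c = (a + b) / 2"
  have bd: "\<bar>f x\<bar> \<le> \<bar>a\<bar> + \<bar>b\<bar>" for x using r[of x] by linarith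
  have W0: "(\<integral>x. W x \<partial>M) = 0" using W(4)[of "\<lambda>_. 1" 1] sets_F[OF A] by (simp add: prob_space)
  have i: "integrable M (\<lambda>x. W x * f x)" using W(4)[OF f bd] by simp
  have "\<bar>(\<integral>x. indicator A x * f x \<partial>M) - prob A * (\<integral>x. f x \<partial>M)\<bar> = \<bar>\<integral>x. W x * f x - W x * c \<partial>M\<bar>"
    using W(4)[OF f bd] W(2) W0 by simp
  also have "\<dots> \<le> (\<integral>x. \<bar>W x * f x - W x * c\<bar> \<partial>M)"
    by (rule integral_abs_bound)
  also have "\<dots> \<le> (\<integral>x. \<bar>W x\<bar> * ((b - a) / 2) \<partial>M)"
  proof (rule integral_mono)
    fix x
    have "\<bar>f x - c\<bar> \<le> (b - a) / 2" using r[of x] unfolding c_def by (auto simp: field_simps abs_le_iff)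
    then have "\<bar>W x\<bar> * \<bar>f x - c\<bar> \<le> \<bar>W x\<bar> * ((b - a) / 2)" by (intro mult_left_mono) auto
    then show "\<bar>W x * f x - W x * c\<bar> \<le> \<bar>W x\<bar> * ((b - a) / 2)"
      by (simp add: abs_mult[symmetric] right_diff_distrib)
  qed (use W(2) i in auto)
  also have "\<dots> = (\<integral>x. \<bar>W x\<bar> \<partial>M) * ((b - a) / 2)" using W(2) by simp
  also have "\<dots> \<le> (2 * p * prob A) * ((b - a) / 2)" using W(3) ab by (intro mult_right_mono) auto
  finally show ?thesis by (simp add: mult_ac)
qed

text \<open>Young's inequality |c| |f| \<le> c^2 / (4 l s) + l s f^2 with s = sqrt p, integrated
  against |W|. The first term meets the L1 bound 2 p P(A) and keeps one factor s; the second carries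
  s already and needs only that |W| is at most the conditional probability of \<open>A\<close> plus
  its probability.\<close>

lemma set_covariance_quad:
  assumes A: "A \<in> sets F" and f: "f \<in> borel_measurable G" and bd: "\<And>x. \<bar>f x\<bar> \<le> C" and l: "0 < l"
  shows "c * ((\<integral>x. indicator A x * f x \<partial>M) - prob A * (\<integral>x. f x \<partial>M)) \<le>
    sqrt p * (c\<^sup>2 / (2 * l) * prob A +
      l * ((\<integral>x. indicator A x * (f x)\<^sup>2 \<partial>M) + prob A * (\<integral>x. (f x)\<^sup>2 \<partial>M)))"
proof -
  obtain W where W: "W \<in> borel_measurable G" "integrable M W" "(\<integral>x. \<bar>W x\<bar> \<partial>M) \<le> 2 * p * prob A"
    "\<And>f C. f \<in> borel_measurable G \<Longrightarrow> (\<And>x. \<bar>f x\<bar> \<le> C) \<Longrightarrow>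
      integrable M (\<lambda>x. W x * f x) \<and>
      (\<integral>x. W x * f x \<partial>M) = (\<integral>x. indicator A x * f x \<partial>M) - prob A * (\<integral>x. f x \<partial>M)"
    "\<And>f C. f \<in> borel_measurable G \<Longrightarrow> (\<And>x. 0 \<le> f x) \<Longrightarrow> (\<And>x. \<bar>f x\<bar> \<le> C) \<Longrightarrow>
      integrable M (\<lambda>x. \<bar>W x\<bar> * f x) \<and>
      (\<integral>x. \<bar>W x\<bar> * f x \<partial>M) \<le> (\<integral>x. indicator A x * f x \<partial>M) + prob A * (\<integral>x. f x \<partial>M)"
    by (rule covariance_density[OF A]) blast
  have i: "integrable M (\<lambda>x. W x * f x)" using W(4)[OF f bd] by simp
  have e: "c * ((\<integral>x. indicator A x * f x \<partial>M) - prob A * (\<integral>x. f x \<partial>M)) = (\<integral>x. c * (W x * f x) \<partial>M)"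
    using W(4)[OF f bd] by simp
  show ?thesis
  proof (cases "p = 0")
    \<comment> \<open>Young's inequality divides by sqrt p, so p = 0 is separate: there the L1 norm
      of \<open>W\<close> vanishes.\<close>
    case True
    then have 0: "(\<integral>x. \<bar>W x\<bar> \<partial>M) \<le> 0" using W(3) by simp
    have C: "0 \<le> C" using bd[of undefined] by linarith
    have "(\<integral>x. c * (W x * f x) \<partial>M) \<le> (\<integral>x. \<bar>W x\<bar> * (\<bar>c\<bar> * C) \<partial>M)"
    proof (rule integral_mono)
      fix x
      have "c * (W x * f x) \<le> \<bar>W x\<bar> * (\<bar>c\<bar> * \<bar>f x\<bar>)"
        using abs_ge_self[of "c * (W x * f x)"] by (simp add: abs_mult mult_ac)
      also have "\<dots> \<le> \<bar>W x\<bar> * (\<bar>c\<bar> * C)" using bd[of x] by (intro mult_left_mono) auto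
      finally show "c * (W x * f x) \<le> \<bar>W x\<bar> * (\<bar>c\<bar> * C)" .
    qed (use i W(2) in auto)
    also have "\<dots> = (\<integral>x. \<bar>W x\<bar> \<partial>M) * (\<bar>c\<bar> * C)" using W(2) by simp
    also have "\<dots> \<le> 0" using 0 C by (intro mult_nonpos_nonneg) auto
    finally show ?thesis unfolding e using True by simp
  next
    case False
    then have p: "0 < p" using p_nonneg by simp
    define s where "s = sqrt p"
    have s: "0 < s" "p = s * s" using p by (auto simp: s_def)
    have f2: "(\<lambda>x. (f x)\<^sup>2) \<in> borel_measurable G" using f by measurable
    have "\<bar>(f x)\<^sup>2\<bar> \<le> C\<^sup>2" for x using power_mono[OF bd[of x], of 2] by simp
    note W5 = W(5)[OF f2 _ this]
    have "(\<integral>x. c * (W x * f x) \<partial>M) \<le> (\<integral>x. \<bar>W x\<bar> * (c\<^sup>2 / (4 * l * s)) + (l * s) * (\<bar>W x\<bar> * (f x)\<^sup>2) \<partial>M)"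
    proof (rule integral_mono)
      fix x
      have "0 \<le> (\<bar>c\<bar> - 2 * l * s * \<bar>f x\<bar>)\<^sup>2" by simp
      also have "\<dots> = c\<^sup>2 + (l * s) * (f x)\<^sup>2 * (4 * l * s) - \<bar>c\<bar> * \<bar>f x\<bar> * (4 * l * s)"
        by (simp add: power2_diff power_mult_distrib power2_eq_square[of l] power2_eq_square[of s])
      finally have "\<bar>c\<bar> * \<bar>f x\<bar> * (4 * l * s) \<le> c\<^sup>2 + (l * s) * (f x)\<^sup>2 * (4 * l * s)" by simp
      then have "\<bar>c\<bar> * \<bar>f x\<bar> \<le> c\<^sup>2 / (4 * l * s) + (l * s) * (f x)\<^sup>2"
        using l s by (simp add: field_simps)
      then have "\<bar>W x\<bar> * (\<bar>c\<bar> * \<bar>f x\<bar>) \<le> \<bar>W x\<bar> * (c\<^sup>2 / (4 * l * s) + (l * s) * (f x)\<^sup>2)"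
        by (intro mult_left_mono) auto
      moreover have "c * (W x * f x) \<le> \<bar>W x\<bar> * (\<bar>c\<bar> * \<bar>f x\<bar>)"
        using abs_ge_self[of "c * (W x * f x)"] by (simp add: abs_mult mult_ac)
      ultimately show "c * (W x * f x) \<le> \<bar>W x\<bar> * (c\<^sup>2 / (4 * l * s)) + (l * s) * (\<bar>W x\<bar> * (f x)\<^sup>2)"
        by (simp add: algebra_simps)
    qed (use i W(2) W5 in auto)
    also have "\<dots> = (\<integral>x. \<bar>W x\<bar> \<partial>M) * (c\<^sup>2 / (4 * l * s)) + (l * s) * (\<integral>x. \<bar>W x\<bar> * (f x)\<^sup>2 \<partial>M)"
      using W(2) W5 by simp
    also have "\<dots> \<le> (2 * p * prob A) * (c\<^sup>2 / (4 * l * s)) +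
        (l * s) * ((\<integral>x. indicator A x * (f x)\<^sup>2 \<partial>M) + prob A * (\<integral>x. (f x)\<^sup>2 \<partial>M))"
      using W(3) W5 l s by (intro add_mono mult_right_mono mult_left_mono) auto
    also have "(2 * p * prob A) * (c\<^sup>2 / (4 * l * s)) = s * (c\<^sup>2 / (2 * l) * prob A)"
      using l s by (simp add: field_simps)
    finally show ?thesis using e by (simp add: s_def algebra_simps)
  qed
qed

end

text \<open>On the event where the conditional expectation is positive its integral is both
  nonnegative and at most 0. This converts inequalities tested on all events of the past into almost
  sure ones.\<close>

lemma (in finite_measure_subalgebra) real_cond_exp_nonpos_if_set:
  assumes u: "integrable M u" and le: "\<And>A. A \<in> sets F \<Longrightarrow> (\<integral>x. indicator A x * u x \<partial>M) \<le> 0"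
  shows "AE x in M. real_cond_exp M F u x \<le> 0"
proof -
  let ?h = "real_cond_exp M F u"
  have sp: "space F = space M" using subalg by (simp add: subalgebra_def)
  define A where "A = {x\<in>space F. 0 < ?h x}"
  have A: "A \<in> sets F" unfolding A_def by measurable
  then have AM: "A \<in> sets M" using subalg by (auto simp: subalgebra_def)
  have uM: "u \<in> borel_measurable M" using u by auto
  have 1: "integrable M (\<lambda>x. indicator A x * u x)"
    using integrable_mult_indicator[OF AM u] by simp
  have hi: "integrable M (\<lambda>x. indicator A x * ?h x)" and e: "(\<integral>x. indicator A x * ?h x \<partial>M) = (\<integral>x. indicator A x * u x \<partial>M)"
    using real_cond_exp_intg[OF 1 _ uM] A by auto
  have nn: "0 \<le> indicator A x * ?h x" for x by (auto simp: A_def indicator_def)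
  have "(\<integral>x. indicator A x * ?h x \<partial>M) = 0"
    using e le[OF A] integral_nonneg_AE[where f="\<lambda>x. indicator A x * ?h x" and M=M] nn by simp
  then have "AE x in M. indicator A x * ?h x = 0"
    using integral_nonneg_eq_0_iff_AE[OF hi] nn by simp
  then show ?thesis
    by (rule AE_mp) (auto intro!: AE_I2 simp: A_def sp indicator_def split: if_splits)
qed

section \<open>Covariance with bounded functions of the past\<close>

context mixing_pair
begin

text \<open>The event version, used with both signs, says that the conditional expectation of
  \<open>f - expectation f\<close> given the past is at most p (b - a) in absolute value almost
  surely. Integrating this against \<open>Z\<close> leaves the L1 norm of \<open>Z\<close>; the
  bound \<open>C\<close> secures integrability and does not enter the estimate.\<close>

lemma covariance_range:
  assumes Z: "Z \<in> borel_measurable F" "\<And>x. \<bar>Z x\<bar> \<le> C"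
    and f: "f \<in> borel_measurable G" and r: "\<And>x. a \<le> f x" "\<And>x. f x \<le> b"
  shows "(\<integral>x. Z x * (f x - expectation f) \<partial>M) \<le> p * (b - a) * (\<integral>x. \<bar>Z x\<bar> \<partial>M)"
proof -
  have [measurable]: "f \<in> borel_measurable M" "Z \<in> borel_measurable M"
    using measurable_from_subalg[OF G f] measurable_from_subalg[OF F Z(1)] by auto
  have bd: "\<bar>f x\<bar> \<le> \<bar>a\<bar> + \<bar>b\<bar>" for x using r[of x] by linarith
  have fi: "integrable M f" by (rule bounded_integrable[OF _ bd]) simp
  define g where "g x = f x - expectation f" for x
  have gi: "integrable M g" using fi by (simp add: g_def[abs_def])
  have [measurable]: "g \<in> borel_measurable M" using gi by auto
  have gA: "integrable M (\<lambda>x. indicator A x * g x)" 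
    "\<bar>\<integral>x. indicator A x * g x \<partial>M\<bar> \<le> p * (b - a) * prob A" if A: "A \<in> sets F" for A
  proof -
    have fA: "integrable M (\<lambda>x. indicator A x * f x)"
      using integrable_mult_indicator[OF sets_F[OF A] fi] by simp
    have iA: "integrable M (indicator A :: _ \<Rightarrow> real)" using sets_F[OF A] by (simp add: integrable_indicator_iff less_top[symmetric])
    have "(\<integral>x. indicator A x * g x \<partial>M) = (\<integral>x. indicator A x * f x - indicator A x * expectation f \<partial>M)"
      by (simp add: g_def right_diff_distrib)
    also have "\<dots> = (\<integral>x. indicator A x * f x \<partial>M) - prob A * expectation f"
      using fA iA sets_F[OF A] by simp
    finally show "\<bar>\<integral>x. indicator A x * g x \<partial>M\<bar> \<le> p * (b - a) * prob A"
      using set_covariance_range[OF A f r] by simp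
    show "integrable M (\<lambda>x. indicator A x * g x)" using integrable_mult_indicator[OF sets_F[OF A] gi] by simp
  qed
  let ?h = "real_cond_exp M F g"
  define K where "K = p * (b - a)"
  have 1: "AE x in M. \<sigma> * ?h x \<le> K" if s: "\<bar>\<sigma>\<bar> = 1" for \<sigma> :: real
  proof -
    have i: "integrable M (\<lambda>x. \<sigma> * g x)" "integrable M (\<lambda>x. K)" using gi by auto
    have "AE x in M. real_cond_exp M F (\<lambda>x. \<sigma> * g x - K) x \<le> 0"
    proof (rule F.real_cond_exp_nonpos_if_set)
      fix A assume A: "A \<in> sets F"
      have iA: "integrable M (indicator A :: _ \<Rightarrow> real)" using sets_F[OF A] by (simp add: integrable_indicator_iff less_top[symmetric])
      have "(\<integral>x. indicator A x * (\<sigma> * g x - K) \<partial>M) = (\<integral>x. \<sigma> * (indicator A x * g x) - K * indicator A x \<partial>M)"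
        by (simp add: algebra_simps)
      also have "\<dots> = \<sigma> * (\<integral>x. indicator A x * g x \<partial>M) - K * prob A"
        using gA(1)[OF A] iA sets_F[OF A] by simp
      also have "\<dots> \<le> 0" using gA(2)[OF A] s unfolding K_def
        by (cases "\<sigma> = 1") (auto simp: abs_if split: if_splits)
      finally show "(\<integral>x. indicator A x * (\<sigma> * g x - K) \<partial>M) \<le> 0" .
    qed (use i in simp)
    moreover have "AE x in M. real_cond_exp M F (\<lambda>x. \<sigma> * g x - K) x
        = real_cond_exp M F (\<lambda>x. \<sigma> * g x) x - real_cond_exp M F (\<lambda>x. K) x" using i by (rule F.real_cond_exp_diff)
    moreover have "AE x in M. real_cond_exp M F (\<lambda>x. \<sigma> * g x) x = \<sigma> * ?h x" using gi by (rule F.real_cond_exp_cmult)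
    moreover have "AE x in M. real_cond_exp M F (\<lambda>x. K) x = K" by (rule F.real_cond_exp_F_meas) auto
    ultimately show ?thesis by eventually_elim linarith
  qed
  have ih: "integrable M (\<lambda>x. Z x * g x)"
    using Z(2) gi by (intro bounded_mult_integrable) auto
  have h: "integrable M (\<lambda>x. Z x * ?h x)" "(\<integral>x. Z x * ?h x \<partial>M) = (\<integral>x. Z x * g x \<partial>M)"
    using F.real_cond_exp_intg[OF ih Z(1)] by auto
  have Zi: "integrable M Z" by (rule bounded_integrable[OF _ Z(2)]) simp
  have "(\<integral>x. Z x * ?h x \<partial>M) \<le> (\<integral>x. K * \<bar>Z x\<bar> \<partial>M)"
  proof (rule integral_mono_AE)
    show "AE x in M. Z x * ?h x \<le> K * \<bar>Z x\<bar>"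
      using 1[of 1, simplified] 1[of "-1", simplified]
    proof eventually_elim
      case (elim x)
      then have "\<bar>?h x\<bar> \<le> K" by linarith
      then have "\<bar>Z x\<bar> * \<bar>?h x\<bar> \<le> \<bar>Z x\<bar> * K" by (intro mult_left_mono) auto
      then show ?case using abs_ge_self[of "Z x * ?h x"] by (simp add: abs_mult mult_ac)
    qed
  qed (use h Zi in auto)
  then show ?thesis using h(2) Zi by (simp add: g_def K_def)
qed

text \<open>For fixed \<open>A\<close> the constant \<open>c\<close> is free in \<open>set_covariance_quad\<close>, so the conditional
  inequality holds almost surely for all rational \<open>c\<close> at once, hence for the random value \<open>c = X x\<close>.\<close>

lemma covariance_quad:
  assumes P: "P \<in> borel_measurable F" "\<And>x. 0 \<le> P x" "\<And>x. P x \<le> C"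
    and X: "X \<in> borel_measurable F" "\<And>x. \<bar>X x\<bar> \<le> D"
    and f: "f \<in> borel_measurable G" and bd: "\<And>x. \<bar>f x\<bar> \<le> E" and l: "0 < l"
  shows "(\<integral>x. P x * X x * (f x - expectation f) \<partial>M) \<le>
    sqrt p * (\<integral>x. P x * ((X x)\<^sup>2 / (2 * l) + l * ((f x)\<^sup>2 + expectation (\<lambda>x. (f x)\<^sup>2))) \<partial>M)"
proof -
  have [measurable]: "f \<in> borel_measurable M" "P \<in> borel_measurable M" "X \<in> borel_measurable M"
    using measurable_from_subalg[OF G f] measurable_from_subalg[OF F P(1)] measurable_from_subalg[OF F X(1)] by auto
  have fi: "integrable M f" by (rule bounded_integrable[OF _ bd]) simp
  have bd2: "\<bar>(f x)\<^sup>2\<bar> \<le> E\<^sup>2" for x using power_mono[OF bd[of x], of 2] by simp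
  have f2i: "integrable M (\<lambda>x. (f x)\<^sup>2)" by (rule bounded_integrable[OF _ bd2]) simp
  define m where "m = expectation (\<lambda>x. (f x)\<^sup>2)"
  define g where "g x = f x - expectation f" for x
  define q where "q x = (f x)\<^sup>2 + m" for x
  have gi: "integrable M g" using fi by (simp add: g_def[abs_def])
  have qi: "integrable M q" using f2i by (simp add: q_def[abs_def])
  have [measurable]: "g \<in> borel_measurable M" "q \<in> borel_measurable M" using gi qi by auto
  let ?h = "real_cond_exp M F g" and ?q = "real_cond_exp M F q"
  define s where "s = sqrt p"
  have *: "AE x in M. c * ?h x \<le> s * (c\<^sup>2 / (2 * l) + l * ?q x)" for c
  proof -
    define K where "K = s * (c\<^sup>2 / (2 * l))"
    have i: "integrable M (\<lambda>x. c * g x)" "integrable M (\<lambda>x. (s * l) * q x)" "integrable M (\<lambda>x. K)"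
      "integrable M (\<lambda>x. c * g x - (s * l) * q x)"
      using gi qi by auto
    have "AE x in M. real_cond_exp M F (\<lambda>x. (c * g x - (s * l) * q x) - K) x \<le> 0"
    proof (rule F.real_cond_exp_nonpos_if_set)
      fix A assume A: "A \<in> sets F"
      have iA: "integrable M (indicator A :: _ \<Rightarrow> real)" using sets_F[OF A] by (simp add: integrable_indicator_iff less_top[symmetric])
      have fA: "integrable M (\<lambda>x. indicator A x * f x)" "integrable M (\<lambda>x. indicator A x * (f x)\<^sup>2)"
        using integrable_mult_indicator[OF sets_F[OF A] fi] integrable_mult_indicator[OF sets_F[OF A] f2i] by auto
      have "(\<integral>x. indicator A x * ((c * g x - (s * l) * q x) - K) \<partial>M) =
        (\<integral>x. c * (indicator A x * f x) - (c * expectation f) * indicator A x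
          - (s * l) * (indicator A x * (f x)\<^sup>2) - (s * l * m) * indicator A x - K * indicator A x \<partial>M)"
        by (simp add: g_def q_def algebra_simps)
      also have "\<dots> = c * (\<integral>x. indicator A x * f x \<partial>M) - (c * expectation f) * prob A
          - (s * l) * (\<integral>x. indicator A x * (f x)\<^sup>2 \<partial>M) - (s * l * m) * prob A - K * prob A"
        using fA iA sets_F[OF A] by simp
      also have "\<dots> \<le> 0" using set_covariance_quad[OF A f bd l, of c]
        by (simp add: K_def s_def m_def algebra_simps)
      finally show "(\<integral>x. indicator A x * ((c * g x - (s * l) * q x) - K) \<partial>M) \<le> 0" .
    qed (use i in simp)
    moreover have "AE x in M. real_cond_exp M F (\<lambda>x. (c * g x - (s * l) * q x) - K) x
        = real_cond_exp M F (\<lambda>x. c * g x - (s * l) * q x) x - real_cond_exp M F (\<lambda>x. K) x"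
      using i by (intro F.real_cond_exp_diff)
    moreover have "AE x in M. real_cond_exp M F (\<lambda>x. c * g x - (s * l) * q x) x
        = real_cond_exp M F (\<lambda>x. c * g x) x - real_cond_exp M F (\<lambda>x. (s * l) * q x) x"
      using i by (intro F.real_cond_exp_diff)
    moreover have "AE x in M. real_cond_exp M F (\<lambda>x. c * g x) x = c * ?h x" using gi by (rule F.real_cond_exp_cmult)
    moreover have "AE x in M. real_cond_exp M F (\<lambda>x. (s * l) * q x) x = (s * l) * ?q x" using qi by (rule F.real_cond_exp_cmult)
    moreover have "AE x in M. real_cond_exp M F (\<lambda>x. K) x = K" by (rule F.real_cond_exp_F_meas) auto
    ultimately show ?thesis by eventually_elim (simp add: K_def algebra_simps)
  qed
  have "AE x in M. \<forall>c\<in>\<rat>. c * ?h x \<le> s * (c\<^sup>2 / (2 * l) + l * ?q x)"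
    using * by (intro AE_ball_countable[THEN iffD2] countable_rat ballI)
  then have ae: "AE x in M. X x * ?h x \<le> s * ((X x)\<^sup>2 / (2 * l) + l * ?q x)"
  proof eventually_elim
    case (elim x)
    have "X x * ?h x - s * ((X x)\<^sup>2 / (2 * l) + l * ?q x) \<le> 0"
      by (rule continuous_le_on_closure[where S = \<rat> and f = "\<lambda>c. c * ?h x - s * (c\<^sup>2 / (2 * l) + l * ?q x)"])
        (use elim l in \<open>auto intro!: continuous_intros simp: Rats_closure_real\<close>)
    then show ?case by simp
  qed
  have D: "0 \<le> D" using X(2)[of undefined] by linarith
  have C: "0 \<le> C" using P(2,3)[of undefined] by linarith
  have PX: "\<bar>P x * X x\<bar> \<le> C * D" for x
    using P(2,3)[of x] X(2)[of x] D by (auto simp: abs_mult intro!: mult_mono)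
  have ig: "integrable M (\<lambda>x. P x * X x * g x)"
    by (rule bounded_mult_integrable[OF _ PX gi]) measurable
  have iq: "integrable M (\<lambda>x. P x * q x)"
    by (rule bounded_mult_integrable[OF _ _ qi, of _ C]) (use P in auto)
  have iX: "integrable M (\<lambda>x. P x * (X x)\<^sup>2)"
  proof (rule bounded_integrable[where C="C * D\<^sup>2"])
    fix x show "\<bar>P x * (X x)\<^sup>2\<bar> \<le> C * D\<^sup>2"
      using P(2,3)[of x] X(2)[of x] C power_mono[of "\<bar>X x\<bar>" D 2] by (auto simp: abs_mult intro!: mult_mono)
  qed measurable
  have hg: "integrable M (\<lambda>x. P x * X x * ?h x)" "(\<integral>x. P x * X x * ?h x \<partial>M) = (\<integral>x. P x * X x * g x \<partial>M)"
    using F.real_cond_exp_intg[OF ig] P(1) X(1) by auto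
  \<comment> \<open>\<open>P\<close> is measurable for the past, so under the weight
    \<open>P\<close> the conditional second moment may be replaced by the square itself.\<close>
  have hq: "integrable M (\<lambda>x. P x * ?q x)" "(\<integral>x. P x * ?q x \<partial>M) = (\<integral>x. P x * q x \<partial>M)"
    using F.real_cond_exp_intg[OF iq] P(1) by auto
  have "(\<integral>x. P x * X x * ?h x \<partial>M) \<le> (\<integral>x. s / (2 * l) * (P x * (X x)\<^sup>2) + (s * l) * (P x * ?q x) \<partial>M)"
  proof (rule integral_mono_AE)
    show "AE x in M. P x * X x * ?h x \<le> s / (2 * l) * (P x * (X x)\<^sup>2) + (s * l) * (P x * ?q x)"
      using ae
    proof eventually_elim
      case (elim x)
      then show ?case using mult_left_mono[OF elim P(2)[of x]] by (simp add: algebra_simps)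
    qed
  qed (use hg hq iX in auto)
  also have "\<dots> = s / (2 * l) * (\<integral>x. P x * (X x)\<^sup>2 \<partial>M) + (s * l) * (\<integral>x. P x * q x \<partial>M)"
    using hq iX by simp
  also have "\<dots> = (\<integral>x. s * (P x * ((X x)\<^sup>2 / (2 * l) + l * q x)) \<partial>M)"
  proof -
    have "(\<lambda>x. s * (P x * ((X x)\<^sup>2 / (2 * l) + l * q x))) = (\<lambda>x. s / (2 * l) * (P x * (X x)\<^sup>2) + (s * l) * (P x * q x))"
      by (auto simp: algebra_simps)
    then show ?thesis using iX iq by simp
  qed
  finally show ?thesis using hg(2) by (simp add: g_def q_def m_def s_def)
qed

end

section \<open>Moment generating functions of mixing sums\<close>

text \<open>Convexity puts exp below its chord on [0, 1/2], and sqrt e \<le> 17/10 bounds the slope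
  of that chord by 7/5. The constant satisfies (7/5)^2 < 2, so a product of two such factors costs
  at most 2.\<close>

lemma exp_minus_one_abs_le:
  fixes y :: real
  assumes "\<bar>y\<bar> \<le> 1 / 2"
  shows "\<bar>exp y - 1\<bar> \<le> 7 / 5 * \<bar>y\<bar>"
proof (cases "0 \<le> y")
  case True
  have "exp (1/2 :: real) \<le> 17 / 10"
  proof (rule power2_le_imp_le)
    have "(exp (1/2 :: real))\<^sup>2 = exp 1" by (simp add: exp_double[symmetric])
    then show "(exp (1/2 :: real))\<^sup>2 \<le> (17 / 10)\<^sup>2" using e_less_272 by (simp add: power2_eq_square)
  qed simp
  moreover have "exp ((1 - 2 * y) *\<^sub>R 0 + (2 * y) *\<^sub>R (1 / 2)) \<le> (1 - 2 * y) * exp 0 + (2 * y) * exp (1/2)"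
    using assms True convex_onD[OF convex_on_exp[of 1], of "2 * y" 0 "1 / 2"] by simp
  ultimately have "exp y \<le> (1 - 2 * y) + (2 * y) * (17 / 10)"
    using True mult_left_mono[of "exp (1/2)" "17/10 :: real" "2 * y"] by simp
  then show ?thesis using True by simp
next
  case False
  then have "\<bar>exp y - 1\<bar> = 1 - exp y" "\<bar>y\<bar> = - y" by auto
  then show ?thesis using exp_ge_add_one_self[of y] False by linarith
qed

lemma two_times_three_power_le_fact: "2 * 3 ^ n \<le> (fact (n + 2) :: real)"
proof (induction n)
  case (Suc n)
  have "2 * 3 ^ Suc n = 3 * (2 * 3 ^ n :: real)" by simp
  also have "\<dots> \<le> (real n + 3) * fact (n + 2)" using Suc by (intro mult_mono) auto
  also have "\<dots> = fact (Suc n + 2)" by (simp add: algebra_simps)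
  finally show ?case .
qed simp

text \<open>From the quadratic term on, the exponential series is dominated by a geometric series of
  ratio |y| / 3, because (n + 2)! is at least 2 * 3^n.\<close>

lemma exp_le_bernstein:
  fixes y :: real
  assumes "\<bar>y\<bar> < 3"
  shows "exp y \<le> 1 + y + y\<^sup>2 / (2 * (1 - \<bar>y\<bar> / 3))"
proof -
  have s: "summable (\<lambda>n. (\<bar>y\<bar> / 3) ^ n)" using assms by (intro summable_geometric) auto
  have se: "summable (\<lambda>n. inverse (fact (n + 2)) *\<^sub>R y ^ (n + 2))"
    using summable_ignore_initial_segment[OF summable_exp_generic[of y], of 2] by simp
  have "inverse (fact (n + 2)) *\<^sub>R y ^ (n + 2) \<le> y\<^sup>2 / 2 * (\<bar>y\<bar> / 3) ^ n" for n
  proof -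
    have "inverse (fact (n + 2)) *\<^sub>R y ^ (n + 2) \<le> inverse (fact (n + 2)) * \<bar>y\<bar> ^ (n + 2)"
      using abs_ge_self[of "y ^ (n + 2)"] by (simp add: power_abs mult_left_mono del: power_Suc)
    also have "\<dots> \<le> inverse (2 * 3 ^ n) * \<bar>y\<bar> ^ (n + 2)"
      using two_times_three_power_le_fact[of n] by (intro mult_right_mono le_imp_inverse_le) auto
    also have "\<dots> = y\<^sup>2 / 2 * (\<bar>y\<bar> / 3) ^ n"
      by (simp add: power_add power_divide field_simps power2_eq_square)
    finally show ?thesis .
  qed
  then have "(\<Sum>n. inverse (fact (n + 2)) *\<^sub>R y ^ (n + 2)) \<le> (\<Sum>n. y\<^sup>2 / 2 * (\<bar>y\<bar> / 3) ^ n)"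
    by (intro suminf_le se summable_mult s)
  also have "\<dots> = y\<^sup>2 / 2 * (1 / (1 - \<bar>y\<bar> / 3))"
    using assms by (subst suminf_mult[OF s]) (simp add: suminf_geometric)
  finally show ?thesis using exp_first_two_terms[of y] by (simp add: field_simps)
qed

lemma exp_le_quadratic:
  fixes y :: real
  assumes "\<bar>y\<bar> \<le> 1"
  shows "exp y \<le> 1 + y + y\<^sup>2"
proof -
  have "y\<^sup>2 / (2 * (1 - \<bar>y\<bar> / 3)) \<le> y\<^sup>2 / 1" using assms by (intro divide_left_mono) auto
  then show ?thesis using exp_le_bernstein[of y] assms by simp
qed

section \<open>Bounded random variables\<close>

context prob_space
begin

text \<open>The bound is required at every point, which makes the class closed under sums and
  products by plain estimates; most integrability goals in the induction on moment generating
  functions reduce to it.\<close>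

definition bounded_rv :: "('a \<Rightarrow> real) \<Rightarrow> bool" where
  "bounded_rv f \<longleftrightarrow> f \<in> borel_measurable M \<and> (\<exists>C. \<forall>x. \<bar>f x\<bar> \<le> C)"

lemma bounded_rvI: "f \<in> borel_measurable M \<Longrightarrow> (\<And>x. \<bar>f x\<bar> \<le> C) \<Longrightarrow> bounded_rv f"
  by (auto simp: bounded_rv_def)

lemma bounded_rv_integrable: "bounded_rv f \<Longrightarrow> integrable M f"
  unfolding bounded_rv_def by (metis (mono_tags) AE_I2 integrable_const_bound real_norm_def)

lemma bounded_rv_const: "bounded_rv (\<lambda>_. c)"
  by (auto simp: bounded_rv_def)

lemma bounded_rv_add:
  assumes "bounded_rv f" "bounded_rv g"
  shows "bounded_rv (\<lambda>x. f x + g x)"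
proof -
  obtain C D where "\<And>x. \<bar>f x\<bar> \<le> C" "\<And>x. \<bar>g x\<bar> \<le> D" using assms by (auto simp: bounded_rv_def)
  then have "\<bar>f x + g x\<bar> \<le> C + D" for x by (rule order_trans[OF abs_triangle_ineq add_mono])
  then show ?thesis using assms by (intro bounded_rvI[where C = "C + D"]) (auto simp: bounded_rv_def)
qed

lemma bounded_rv_mult:
  assumes "bounded_rv f" "bounded_rv g"
  shows "bounded_rv (\<lambda>x. f x * g x)"
proof -
  obtain C D where C: "\<And>x. \<bar>f x\<bar> \<le> C" and D: "\<And>x. \<bar>g x\<bar> \<le> D"
    using assms by (auto simp: bounded_rv_def)
  have "0 \<le> C" using C[of undefined] by linarith
  then have "\<bar>f x * g x\<bar> \<le> C * D" for x
    unfolding abs_mult using C D by (intro mult_mono) auto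
  then show ?thesis using assms by (intro bounded_rvI[where C = "C * D"]) (auto simp: bounded_rv_def)
qed

lemma bounded_rv_diff: "bounded_rv f \<Longrightarrow> bounded_rv g \<Longrightarrow> bounded_rv (\<lambda>x. f x - g x)"
  using bounded_rv_add[of f "\<lambda>x. -1 * g x"] bounded_rv_mult[OF bounded_rv_const, of g "-1"] by simp

lemma bounded_rv_power2: "bounded_rv f \<Longrightarrow> bounded_rv (\<lambda>x. (f x)\<^sup>2)"
  unfolding power2_eq_square by (rule bounded_rv_mult)

lemmas bounded_rv_intros = bounded_rv_const bounded_rv_add bounded_rv_mult bounded_rv_diff bounded_rv_power2

end

text \<open>Identical margins are what i.i.d. and stationary sequences have in common, so both cases
  of the theorem instantiate this locale.\<close>

locale phi_process = prob_space +
  fixes U :: "nat \<Rightarrow> 'a \<Rightarrow> real"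
  assumes U_measurable: "1 \<le> t \<Longrightarrow> U t \<in> borel_measurable M"
    and ident_distr: "1 \<le> t \<Longrightarrow> distr M borel (U t) = distr M borel (U 1)"
begin

abbreviation \<phi> :: "nat \<Rightarrow> real" where "\<phi> n \<equiv> phi_mix_coeff M U n"

text \<open>\<open>past\<close> and \<open>present\<close> present the sigma-algebras behind the
  coefficients as measure spaces, the form in which conditional expectations take them; only their
  sets matter.\<close>

definition past :: "nat \<Rightarrow> 'a measure" where
  "past m = sigma (space M) (\<Union>i\<in>{1..m}. {U i -` B \<inter> space M | B. B \<in> sets (borel :: real measure)})"

definition present :: "nat \<Rightarrow> 'a measure" where
  "present t = vimage_algebra (space M) (U t) borel"

lemma sets_past: "sets (past m) = past_sigma M U m"
  unfolding past_def past_sigma_def by (subst sets_measure_of) auto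

lemma space_past: "space (past m) = space M"
  unfolding past_def by (subst space_measure_of) auto

lemma sets_present: "sets (present t) = single_sigma M U t"
  unfolding present_def single_sigma_def by (subst sets_vimage_algebra2) auto

lemma subalgebra_past: "subalgebra M (past m)"
proof -
  have "sigma_sets (space M) (\<Union>i\<in>{1..m}. {U i -` B \<inter> space M | B. B \<in> sets (borel :: real measure)}) \<subseteq> sets M"
    by (rule sets.sigma_sets_subset) (auto intro: measurable_sets[OF U_measurable])
  then show ?thesis by (simp add: subalgebra_def space_past sets_past past_sigma_def)
qed

lemma subalgebra_present: "1 \<le> t \<Longrightarrow> subalgebra M (present t)"
  by (auto simp: subalgebra_def sets_present single_sigma_def intro: measurable_sets[OF U_measurable])
    (auto simp: present_def)

lemma U_past: "1 \<le> i \<Longrightarrow> i \<le> m \<Longrightarrow> U i \<in> borel_measurable (past m)"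
proof (rule measurableI)
  fix A :: "real set" assume "1 \<le> i" "i \<le> m" "A \<in> sets borel"
  then have "U i -` A \<inter> space M \<in> (\<Union>i\<in>{1..m}. {U i -` B \<inter> space M | B. B \<in> sets (borel :: real measure)})"
    by (intro UN_I[of i]) auto
  then show "U i -` A \<inter> space (past m) \<in> sets (past m)"
    unfolding space_past sets_past past_sigma_def by (rule sigma_sets.Basic)
qed simp

lemma U_present: "U t \<in> borel_measurable (present t)"
  unfolding present_def by (rule measurable_vimage_algebra1) simp

text \<open>A difference of two numbers in [0, 1]. The coefficient is a supremum of reals and
  dominates its members only for a set bounded above; this is the bound.\<close>

lemma phi_term_le_1:
  assumes "A \<in> past_sigma M U m"
  shows "\<bar>prob (A \<inter> B) / prob A - prob B\<bar> \<le> 1"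
proof -
  have "A \<in> sets M" using assms subalgebra_past by (auto simp: subalgebra_def sets_past)
  then have "prob (A \<inter> B) \<le> prob A" by (intro finite_measure_mono) auto
  then have "0 \<le> prob (A \<inter> B) / prob A" "prob (A \<inter> B) / prob A \<le> 1"
    by (auto simp: divide_le_eq_1 zero_less_measure_iff)
  moreover have "0 \<le> prob B" "prob B \<le> 1" by auto
  ultimately show ?thesis by linarith
qed

text \<open>Multiplying by P(A) brings in the null events \<open>A\<close>, which the coefficient
  excludes and for which both sides vanish. This is the form that \<open>mixing_pair\<close> asks
  for on every event.\<close>

lemma phi_coeff_bound:
  assumes m: "1 \<le> m" and A: "A \<in> past_sigma M U m" and B: "B \<in> single_sigma M U (m + n)"
  shows "\<bar>prob (A \<inter> B) - prob A * prob B\<bar> \<le> \<phi> n * prob A"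
proof (cases "prob A = 0")
  case True
  have "A \<in> sets M" using A subalgebra_past by (auto simp: subalgebra_def sets_past)
  then have "prob (A \<inter> B) \<le> prob A" by (intro finite_measure_mono) auto
  then show ?thesis using True measure_nonneg[of M "A \<inter> B"] by simp
next
  case False
  then have p: "0 < prob A" by (simp add: zero_less_measure_iff)
  have "\<bar>prob (A \<inter> B) / prob A - prob B\<bar> \<le> \<phi> n"
    unfolding phi_mix_coeff_def
    by (rule cSup_upper) (use assms p in blast, use phi_term_le_1 in \<open>fastforce intro!: bdd_aboveI\<close>)
  then have "\<bar>prob (A \<inter> B) / prob A - prob B\<bar> * prob A \<le> \<phi> n * prob A"
    using p by (intro mult_right_mono) auto
  moreover have "\<bar>prob (A \<inter> B) / prob A - prob B\<bar> * prob A = \<bar>(prob (A \<inter> B) / prob A - prob B) * prob A\<bar>"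
    using p by (simp add: abs_mult)
  moreover have "(prob (A \<inter> B) / prob A - prob B) * prob A = prob (A \<inter> B) - prob A * prob B"
    using p by (simp add: field_simps)
  ultimately show ?thesis by simp
qed

lemma space_in_sigmas: "space M \<in> past_sigma M U m" "space M \<in> single_sigma M U t"
  using sets.top[of "past m"] sets.top[of "present t"]
  by (simp_all only: sets_past space_past sets_present) (simp add: present_def)

lemma phi_nonneg: "0 \<le> \<phi> n"
  using phi_coeff_bound[OF order_refl space_in_sigmas, of n] by (simp add: prob_space)

lemma phi_le_1: "\<phi> n \<le> 1"
  unfolding phi_mix_coeff_def
proof (rule cSup_least)
  show "{\<bar>measure M (A \<inter> B) / measure M A - measure M B\<bar> | m A B.
      1 \<le> m \<and> A \<in> past_sigma M U m \<and> measure M A > 0 \<and> B \<in> single_sigma M U (m + n)} \<noteq> {}"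
    using space_in_sigmas prob_space by (fastforce intro!: exI[of _ "1::nat"])
qed (use phi_term_le_1 in blast)

lemma mixing_pair_past_present:
  assumes "1 \<le> m"
  shows "mixing_pair M (past m) (present (m + n)) (\<phi> n)"
proof
  show "subalgebra M (past m)" by (rule subalgebra_past)
  show "subalgebra M (present (m + n))" using assms by (intro subalgebra_present) simp
  show "0 \<le> \<phi> n" by (rule phi_nonneg)
  show "\<bar>prob (A \<inter> B) - prob A * prob B\<bar> \<le> \<phi> n * prob A"
    if "A \<in> sets (past m)" "B \<in> sets (present (m + n))" for A B
    using phi_coeff_bound[OF assms] that by (simp add: sets_past sets_present)
qed

lemma expectation_ident:
  fixes F :: "real \<Rightarrow> real"
  assumes "F \<in> borel_measurable borel" "1 \<le> t"
  shows "expectation (\<lambda>x. F (U t x)) = expectation (\<lambda>x. F (U 1 x))"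
proof -
  have "expectation (\<lambda>x. F (U t x)) = (\<integral>u. F u \<partial>distr M borel (U t))"
    using assms by (intro integral_distr[symmetric] U_measurable)
  also have "\<dots> = (\<integral>u. F u \<partial>distr M borel (U 1))" using ident_distr[OF assms(2)] by simp
  also have "\<dots> = expectation (\<lambda>x. F (U 1 x))"
    using assms by (intro integral_distr U_measurable) auto
  finally show ?thesis .
qed

end

text \<open>The distances n - i are distinct elements of 1, ..., n - 1, also when n lies well beyond
  j. So one bound on the partial sums of the coefficients serves every pair of j and n.\<close>

lemma sum_diff_le_sum:
  fixes f :: "nat \<Rightarrow> real"
  assumes "j < n" "\<And>k. 0 \<le> f k"
  shows "(\<Sum>i\<in>{1..j}. f (n - i)) \<le> (\<Sum>k\<in>{1..n-1}. f k)"
proof -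
  have "(\<Sum>i\<in>{1..j}. f (n - i)) \<le> (\<Sum>i\<in>{1..n-1}. f (n - i))"
    using assms by (intro sum_mono2) auto
  also have "\<dots> = (\<Sum>k\<in>{1..n-1}. f k)"
    using sum.atLeastAtMost_rev[of f 1 "n - 1"] assms(1) by simp
  finally show ?thesis .
qed

text \<open>\<open>g\<close> stands for the centred loss as a function of the raw one and
  \<open>l\<close> for the parameter of the moment generating function; \<open>l \<le> 1 / 2\<close>
  is the range of the linear bound on \<open>exp y - 1\<close>.\<close>

locale bounded_phi_process = phi_process +
  fixes g :: "real \<Rightarrow> real" and l :: real
  assumes g_measurable [measurable]: "g \<in> borel_measurable borel"
    and g_le_1: "\<bar>g u\<bar> \<le> 1" and l_pos: "0 < l" and l_le: "l \<le> 1 / 2"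
begin

definition V :: "nat \<Rightarrow> 'a \<Rightarrow> real" where "V s x = g (U s x)"

definition P :: "nat \<Rightarrow> 'a \<Rightarrow> real" where "P j x = exp (l * (\<Sum>s\<in>{1..j}. V s x))"

text \<open>The relative increment of \<open>P\<close>: for i \<ge> 1,
  \<open>P i - P (i - 1)\<close> is \<open>P (i - 1) * X i\<close>. It is of order l.\<close>

definition X :: "nat \<Rightarrow> 'a \<Rightarrow> real" where "X i x = exp (l * V i x) - 1"

lemma V_le: "\<bar>V s x\<bar> \<le> 1"
  using g_le_1 by (simp add: V_def)

lemma P_pos: "0 < P j x" by (simp add: P_def)

lemma P_le: "P j x \<le> exp (l * real j)"
proof -
  have "(\<Sum>s\<in>{1..j}. V s x) \<le> (\<Sum>s\<in>{1..j}. 1)"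
    using V_le by (intro sum_mono) (metis abs_le_D1)
  then show ?thesis using l_pos by (simp add: P_def)
qed

lemma P_0: "P 0 x = 1" by (simp add: P_def)

lemma P_Suc: "P (Suc j) x = P j x * exp (l * V (Suc j) x)"
  by (simp add: P_def distrib_left exp_add)

lemma X_le: "\<bar>X i x\<bar> \<le> 7 / 5 * l * \<bar>V i x\<bar>"
proof -
  have "l * \<bar>V i x\<bar> \<le> (1/2) * 1" using V_le l_pos l_le by (intro mult_mono) auto
  then have "\<bar>l * V i x\<bar> \<le> 1 / 2" using l_pos by (simp add: abs_mult)
  from exp_minus_one_abs_le[OF this] show ?thesis using l_pos by (simp add: X_def abs_mult)
qed

lemma X_le': "\<bar>X i x\<bar> \<le> 7 / 5 * l"
proof -
  have "7 / 5 * l * \<bar>V i x\<bar> \<le> 7 / 5 * l * 1" using V_le l_pos by (intro mult_left_mono) auto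
  then show ?thesis using X_le[of i x] by linarith
qed

text \<open>Here 49/25 \<le> 2 pays off: the past square in \<open>covariance_quad\<close> takes the
  same form l V^2 as the future one.\<close>

lemma X_sq_le: "(X i x)\<^sup>2 / (2 * l) \<le> l * (V i x)\<^sup>2"
proof -
  have "(X i x)\<^sup>2 \<le> (7 / 5 * l * \<bar>V i x\<bar>)\<^sup>2" using power_mono[OF X_le, of i x 2] by simp
  also have "\<dots> = 49 / 25 * (l\<^sup>2 * (V i x)\<^sup>2)" by (simp add: power_mult_distrib power2_eq_square)
  also have "\<dots> \<le> 2 * (l\<^sup>2 * (V i x)\<^sup>2)" by (rule mult_right_mono) auto
  finally have "(X i x)\<^sup>2 \<le> 2 * (l\<^sup>2 * (V i x)\<^sup>2)" .
  then show ?thesis using l_pos by (simp add: field_simps power2_eq_square)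
qed

lemma V_past [measurable]: "1 \<le> i \<Longrightarrow> i \<le> m \<Longrightarrow> V i \<in> borel_measurable (past m)"
  using measurable_compose[OF U_past g_measurable] by (simp add: V_def[abs_def])

lemma P_past: "j \<le> m \<Longrightarrow> P j \<in> borel_measurable (past m)"
  unfolding P_def[abs_def]
  by (intro borel_measurable_exp[THEN measurable_compose[rotated]] borel_measurable_times borel_measurable_const borel_measurable_sum V_past) auto

lemma X_past: "1 \<le> i \<Longrightarrow> i \<le> m \<Longrightarrow> X i \<in> borel_measurable (past m)"
  unfolding X_def[abs_def] by measurable

lemma bounded_rv_V: "1 \<le> i \<Longrightarrow> bounded_rv (V i)"
  using measurable_from_subalg[OF subalgebra_past V_past, of i i] V_le by (auto intro!: bounded_rvI)

lemma bounded_rv_P: "bounded_rv (P j)"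
  using measurable_from_subalg[OF subalgebra_past P_past, of j j] P_le[of j] P_pos[of j]
  by (auto intro!: bounded_rvI[of _ "exp (l * real j)"] simp: abs_of_pos)

lemma bounded_rv_X: "1 \<le> i \<Longrightarrow> bounded_rv (X i)"
  using measurable_from_subalg[OF subalgebra_past X_past, of i i] by (auto intro: bounded_rvI[OF _ X_le'])

lemma bounded_rv_U:
  assumes "F \<in> borel_measurable borel" "\<And>u. \<bar>F u\<bar> \<le> C" "1 \<le> n"
  shows "bounded_rv (\<lambda>x. F (U n x))"
  using measurable_compose[OF U_measurable[OF assms(3)] assms(1)] assms(2) by (rule bounded_rvI)

text \<open>The initial term \<open>P 0 = 1\<close> meets a centred variable and contributes
  nothing.\<close>

lemma telescope:
  assumes f: "bounded_rv f"
  shows "expectation (\<lambda>x. P j x * (f x - expectation f)) =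
    (\<Sum>i\<in>{1..j}. expectation (\<lambda>x. P (i - 1) x * X i x * (f x - expectation f)))"
proof (induction j)
  case 0
  have "integrable M f" using f by (rule bounded_rv_integrable)
  then show ?case by (simp add: P_0 prob_space)
next
  case (Suc j)
  let ?f = "\<lambda>x. f x - expectation f"
  have b: "bounded_rv ?f" by (intro bounded_rv_intros f)
  have "expectation (\<lambda>x. P (Suc j) x * ?f x) = expectation (\<lambda>x. P j x * ?f x + P j x * X (Suc j) x * ?f x)"
    by (rule Bochner_Integration.integral_cong) (auto simp: P_Suc X_def algebra_simps)
  also have "\<dots> = expectation (\<lambda>x. P j x * ?f x) + expectation (\<lambda>x. P j x * X (Suc j) x * ?f x)"
    by (intro Bochner_Integration.integral_add bounded_rv_integrable bounded_rv_mult bounded_rv_P bounded_rv_X b) simp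
  finally show ?case using Suc.IH by simp
qed

definition G :: "nat \<Rightarrow> real" where "G j = expectation (P j)"

lemma G_nonneg: "0 \<le> G j"
  unfolding G_def by (rule Bochner_Integration.integral_nonneg) (simp add: P_def)

lemma G_0: "G 0 = 1" by (simp add: G_def P_0[abs_def] prob_space)

text \<open>The increment involves rounds up to i, so the gap is n - i. The bound 7/5 l on
  \<open>X i\<close> then replaces its L1 norm by l times the mean of \<open>P (i - 1)\<close>, a
  quantity of the induction.\<close>

lemma step_range:
  assumes i: "1 \<le> i" "i < n" and F: "F \<in> borel_measurable borel" and r: "\<And>u. a \<le> F u" "\<And>u. F u \<le> b"
  shows "expectation (\<lambda>x. P (i - 1) x * X i x * (F (U n x) - expectation (\<lambda>x. F (U n x))))
    \<le> \<phi> (n - i) * (b - a) * (7 / 5 * l * G (i - 1))"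
proof -
  interpret mp: mixing_pair M "past i" "present n" "\<phi> (n - i)"
    using mixing_pair_past_present[OF i(1), of "n - i"] i by simp
  have ab: "a \<le> b" using r[of undefined] by linarith
  have fm: "(\<lambda>x. F (U n x)) \<in> borel_measurable (present n)"
    using measurable_compose[OF U_present F] .
  have Zm: "(\<lambda>x. P (i - 1) x * X i x) \<in> borel_measurable (past i)"
    using P_past[of "i - 1" i] X_past[of i i] i by simp
  have Zb: "\<bar>P (i - 1) x * X i x\<bar> \<le> P (i - 1) x * (7 / 5 * l)" for x
    using X_le'[of i x] P_pos[of "i - 1" x] by (simp add: abs_mult)
  have Zb2: "\<bar>P (i - 1) x * X i x\<bar> \<le> exp (l * real (i - 1)) * (7 / 5 * l)" for x
    using Zb[of x] mult_right_mono[OF P_le[of "i - 1" x], of "7 / 5 * l"] l_pos by linarith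
  have bZ: "bounded_rv (\<lambda>x. P (i - 1) x * X i x)"
    by (intro bounded_rv_mult bounded_rv_P bounded_rv_X i)
  have "expectation (\<lambda>x. P (i - 1) x * X i x * (F (U n x) - expectation (\<lambda>x. F (U n x))))
    \<le> \<phi> (n - i) * (b - a) * expectation (\<lambda>x. \<bar>P (i - 1) x * X i x\<bar>)"
    using mp.covariance_range[OF Zm Zb2 fm, of a b] r by simp
  also have "\<dots> \<le> \<phi> (n - i) * (b - a) * expectation (\<lambda>x. P (i - 1) x * (7 / 5 * l))"
    using ab phi_nonneg Zb bounded_rv_integrable[OF bZ] bounded_rv_integrable[OF bounded_rv_P]
    by (intro mult_left_mono integral_mono) auto
  finally show ?thesis by (simp add: G_def mult_ac)
qed

definition Q :: "nat \<Rightarrow> nat \<Rightarrow> real" where "Q j n = expectation (\<lambda>x. P j x * (V n x)\<^sup>2)"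

text \<open>\<open>covariance_quad\<close> with weight \<open>P (i - 1)\<close>, past factor
  \<open>X i\<close> and scale l; all squares come out with the common factor l. The condition |F|
  \<le> |g| admits \<open>g\<close> itself, for the linear term of the generating function, and its
  square, for the tilted second moment, since |g| \<le> 1.\<close>

lemma step_quad:
  assumes i: "1 \<le> i" "i < n" and F: "F \<in> borel_measurable borel" and r: "\<And>u. \<bar>F u\<bar> \<le> \<bar>g u\<bar>"
  shows "expectation (\<lambda>x. P (i - 1) x * X i x * (F (U n x) - expectation (\<lambda>x. F (U n x))))
    \<le> l * sqrt (\<phi> (n - i)) * (Q (i - 1) i + Q (i - 1) n + expectation (\<lambda>x. (V n x)\<^sup>2) * G (i - 1))"
proof -
  interpret mp: mixing_pair M "past i" "present n" "\<phi> (n - i)"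
    using mixing_pair_past_present[OF i(1), of "n - i"] i by simp
  have n: "1 \<le> n" using i by simp
  have fm: "(\<lambda>x. F (U n x)) \<in> borel_measurable (present n)"
    using measurable_compose[OF U_present F] .
  have F1: "\<bar>F u\<bar> \<le> 1" for u using r[of u] g_le_1[of u] by linarith
  have F2: "(F (U n x))\<^sup>2 \<le> (V n x)\<^sup>2" for x
    using r[of "U n x"] unfolding V_def by (rule abs_le_square_iff[THEN iffD1])
  have bF: "bounded_rv (\<lambda>x. F (U n x))" by (rule bounded_rv_U[OF F F1 n])
  note bi = bounded_rv_intros bounded_rv_P bounded_rv_X[OF i(1)] bounded_rv_V[OF i(1)] bounded_rv_V[OF n] bF
  let ?m = "expectation (\<lambda>x. (F (U n x))\<^sup>2)" and ?v = "expectation (\<lambda>x. (V n x)\<^sup>2)"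
  have mv: "?m \<le> ?v" by (intro integral_mono bounded_rv_integrable bi F2)
  have "expectation (\<lambda>x. P (i - 1) x * X i x * (F (U n x) - expectation (\<lambda>x. F (U n x))))
    \<le> sqrt (\<phi> (n - i)) * expectation (\<lambda>x. P (i - 1) x * ((X i x)\<^sup>2 / (2 * l) + l * ((F (U n x))\<^sup>2 + ?m)))"
    by (rule mp.covariance_quad[where C="exp (l * real (i - 1))" and D="7 / 5 * l" and E=1,
          OF P_past P_pos[THEN less_imp_le] P_le X_past X_le' fm F1 l_pos]) (use i in auto)
  also have "\<dots> \<le> sqrt (\<phi> (n - i)) * expectation (\<lambda>x. l * (P (i - 1) x * (V i x)\<^sup>2) + l * (P (i - 1) x * (V n x)\<^sup>2) + l * ?v * P (i - 1) x)"
  proof (intro mult_left_mono integral_mono)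
    show "integrable M (\<lambda>x. P (i - 1) x * ((X i x)\<^sup>2 / (2 * l) + l * ((F (U n x))\<^sup>2 + ?m)))"
      unfolding divide_inverse by (intro bounded_rv_integrable bi)
    show "integrable M (\<lambda>x. l * (P (i - 1) x * (V i x)\<^sup>2) + l * (P (i - 1) x * (V n x)\<^sup>2) + l * ?v * P (i - 1) x)"
      by (intro bounded_rv_integrable bi)
    fix x
    have "(X i x)\<^sup>2 / (2 * l) + l * ((F (U n x))\<^sup>2 + ?m) \<le> l * (V i x)\<^sup>2 + l * ((V n x)\<^sup>2 + ?v)"
      using X_sq_le F2 mv l_pos by (intro add_mono mult_left_mono) auto
    from mult_left_mono[OF this P_pos[THEN less_imp_le, of "i - 1" x]]
    show "P (i - 1) x * ((X i x)\<^sup>2 / (2 * l) + l * ((F (U n x))\<^sup>2 + ?m))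
      \<le> l * (P (i - 1) x * (V i x)\<^sup>2) + l * (P (i - 1) x * (V n x)\<^sup>2) + l * ?v * P (i - 1) x"
      by (simp add: algebra_simps)
  qed (simp add: phi_nonneg)
  also have "expectation (\<lambda>x. l * (P (i - 1) x * (V i x)\<^sup>2) + l * (P (i - 1) x * (V n x)\<^sup>2) + l * ?v * P (i - 1) x)
    = l * Q (i - 1) i + l * Q (i - 1) n + l * ?v * G (i - 1)"
  proof -
    have "integrable M (\<lambda>x. P (i - 1) x * (V i x)\<^sup>2)" "integrable M (\<lambda>x. P (i - 1) x * (V n x)\<^sup>2)" "integrable M (P (i - 1))"
      by (intro bounded_rv_integrable bi)+
    then show ?thesis by (simp add: Q_def G_def)
  qed
  finally show ?thesis by (simp add: algebra_simps)
qed

text \<open>With f = exp (l V n), \<open>G n\<close> is \<open>G (n - 1)\<close> times the mean of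
  f, plus a covariance. Hoeffding's lemma bounds the mean by exp (l^2 / 8), and the increments add
  at most 2 l^2 Phi \<rho>^(n-1). The induction is strong because increment i is paid for with
  \<open>G (i - 1)\<close>. For l \<le> 1/2 the two parts amount to at most 1 + l^2 / 4 + 2 l^2 Phi,
  which is below \<rho>.\<close>

theorem mgf_hoeffding:
  assumes a: "-1 \<le> a" "a \<le> 0" and r: "\<And>u. a \<le> g u" "\<And>u. g u \<le> a + 1"
    and mean: "expectation (\<lambda>x. g (U 1 x)) = 0"
    and Phi: "\<And>m. (\<Sum>n\<in>{1..m}. \<phi> n) \<le> Phi"
  shows "G n \<le> exp (l\<^sup>2 * (1 + 4 * Phi) / 2) ^ n"
proof (induction n rule: less_induct)
  case (less n)
  define \<rho> where "\<rho> = exp (l\<^sup>2 * (1 + 4 * Phi) / 2)"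
  have Phi0: "0 \<le> Phi" using Phi[of 0] by simp
  have \<rho>1: "1 \<le> \<rho>" unfolding \<rho>_def using Phi0 by simp
  show ?case
  proof (cases n)
    case 0
    then show ?thesis by (simp add: G_0)
  next
    case (Suc j)
    have n: "1 \<le> n" "j < n" using Suc by auto
    define f where "f x = exp (l * g (U n x))" for x
    have F: "(\<lambda>u. exp (l * g u)) \<in> borel_measurable borel" by measurable
    have Fr: "exp (l * a) \<le> exp (l * g u)" "exp (l * g u) \<le> exp (l * (a + 1))" for u
      using r l_pos by auto
    have bf: "bounded_rv f" unfolding f_def[abs_def]
      by (rule bounded_rv_U[OF F _ n(1), of "exp (l * (a + 1))"]) (use Fr in auto)
    \<comment> \<open>The exponential of a variable of range 1 has a range of order l; a \<le> 0
      keeps the factor exp (l a) at most 1.\<close>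
    have width: "exp (l * (a + 1)) - exp (l * a) \<le> 7 / 5 * l"
    proof -
      have "exp (l * (a + 1)) - exp (l * a) = exp (l * a) * (exp l - 1)"
        by (simp add: algebra_simps exp_add)
      also have "\<dots> \<le> 1 * (7 / 5 * l)"
        using exp_minus_one_abs_le[of l] l_pos l_le a by (intro mult_mono) (auto simp: mult_nonneg_nonpos)
      finally show ?thesis by simp
    qed
    have Ef: "expectation f \<le> exp (l\<^sup>2 / 8)"
    proof -
      interpret h: interval_bounded_random_variable M "\<lambda>x. g (U n x)" a "a + 1"
        by unfold_locales (use r measurable_compose[OF U_measurable[OF n(1)] g_measurable] in auto)
      have "(\<integral>\<^sup>+x. exp (l * g (U n x)) \<partial>M) \<le> ennreal (exp (l\<^sup>2 * (a + 1 - a)\<^sup>2 / 8))"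
        using mean expectation_ident[OF g_measurable n(1)] l_pos by (intro h.Hoeffdings_lemma_nn_integral_0) auto
      then have "ennreal (expectation f) \<le> ennreal (exp (l\<^sup>2 / 8))"
        using nn_integral_eq_integral[OF bounded_rv_integrable[OF bf]] by (simp add: f_def)
      then show ?thesis by simp
    qed
    have step: "expectation (\<lambda>x. P (i - 1) x * X i x * (f x - expectation f)) \<le> \<phi> (n - i) * (2 * l\<^sup>2 * \<rho> ^ j)"
      if i: "i \<in> {1..j}" for i
    proof -
      have i': "1 \<le> i" "i < n" using i n by auto
      have G: "G (i - 1) \<le> \<rho> ^ j"
      proof -
        have "G (i - 1) \<le> \<rho> ^ (i - 1)" unfolding \<rho>_def by (rule less.IH) (use i' in simp)
        also have "\<dots> \<le> \<rho> ^ j" using \<rho>1 i by (intro power_increasing) auto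
        finally show ?thesis .
      qed
      have "expectation (\<lambda>x. P (i - 1) x * X i x * (f x - expectation f)) \<le>
          \<phi> (n - i) * (exp (l * (a + 1)) - exp (l * a)) * (7 / 5 * l * G (i - 1))"
        unfolding f_def using step_range[OF i' F Fr] by simp
      also have "\<dots> \<le> \<phi> (n - i) * (7 / 5 * l) * (7 / 5 * l * \<rho> ^ j)"
        using width phi_nonneg l_pos G G_nonneg \<rho>1 by (intro mult_mono mult_nonneg_nonneg) auto
      \<comment> \<open>One factor 7/5 l is the width of the future variable, the other the size of
        the increment.\<close>
      also have "\<dots> = \<phi> (n - i) * (49 / 25 * (l\<^sup>2 * \<rho> ^ j))" by (simp add: power2_eq_square)
      also have "\<dots> \<le> \<phi> (n - i) * (2 * (l\<^sup>2 * \<rho> ^ j))"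
        using phi_nonneg \<rho>1 by (intro mult_left_mono mult_right_mono) auto
      finally show ?thesis by (simp add: mult_ac)
    qed
    have "expectation (\<lambda>x. P j x * (f x - expectation f)) \<le> (\<Sum>i\<in>{1..j}. \<phi> (n - i) * (2 * l\<^sup>2 * \<rho> ^ j))"
      unfolding telescope[OF bf] by (rule sum_mono) (rule step)
    also have "\<dots> = (\<Sum>i\<in>{1..j}. \<phi> (n - i)) * (2 * l\<^sup>2 * \<rho> ^ j)"
      by (rule sum_distrib_right[symmetric])
    also have "\<dots> \<le> Phi * (2 * l\<^sup>2 * \<rho> ^ j)"
      using order_trans[OF sum_diff_le_sum[OF n(2), of \<phi>] Phi] phi_nonneg \<rho>1 by (intro mult_right_mono) auto
    finally have cov: "expectation (\<lambda>x. P j x * (f x - expectation f)) \<le> Phi * (2 * l\<^sup>2 * \<rho> ^ j)" .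
    have ints: "integrable M (\<lambda>x. P j x * (f x - expectation f))" "integrable M (P j)"
      by (intro bounded_rv_integrable bounded_rv_intros bounded_rv_P bf)+
    have "G n = expectation (\<lambda>x. P j x * (f x - expectation f) + expectation f * P j x)"
      unfolding G_def Suc by (rule Bochner_Integration.integral_cong) (auto simp: P_Suc f_def V_def Suc algebra_simps)
    also have "\<dots> = expectation (\<lambda>x. P j x * (f x - expectation f)) + expectation f * G j"
      using ints by (simp add: G_def)
    also have "\<dots> \<le> Phi * (2 * l\<^sup>2 * \<rho> ^ j) + exp (l\<^sup>2 / 8) * \<rho> ^ j"
      using cov Ef less.IH[OF n(2)] G_nonneg by (intro add_mono mult_mono) (auto simp: \<rho>_def)
    also have "\<dots> = (2 * l\<^sup>2 * Phi + exp (l\<^sup>2 / 8)) * \<rho> ^ j" by (simp add: algebra_simps)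
    also have "\<dots> \<le> \<rho> * \<rho> ^ j"
    proof (rule mult_right_mono)
      have l2: "l\<^sup>2 \<le> 1 / 4" using power_mono[OF l_le, of 2] l_pos by (simp add: power2_eq_square)
      have "exp (l\<^sup>2 / 8) \<le> 1 + l\<^sup>2 / 8 + (l\<^sup>2 / 8)\<^sup>2" by (rule exp_bound) (use l2 in auto)
      also have "(l\<^sup>2 / 8)\<^sup>2 \<le> l\<^sup>2 / 8 * 1" unfolding power2_eq_square[of "l\<^sup>2 / 8"] using l2 by (intro mult_left_mono) auto
      also have "1 + l\<^sup>2 / 8 + l\<^sup>2 / 8 * 1 \<le> 1 + l\<^sup>2 / 2" by simp
      finally have "2 * l\<^sup>2 * Phi + exp (l\<^sup>2 / 8) \<le> 1 + l\<^sup>2 * (1 + 4 * Phi) / 2"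
        by (simp add: distrib_left add_divide_distrib)
      also have "\<dots> \<le> \<rho>" unfolding \<rho>_def by (rule exp_ge_add_one_self)
      finally show "2 * l\<^sup>2 * Phi + exp (l\<^sup>2 / 8) \<le> \<rho>" .
    qed (use \<rho>1 in simp)
    finally show ?thesis using Suc by (simp add: \<rho>_def)
  qed
qed

text \<open>The two bounds \<open>G j \<le> \<rho> ^ j\<close> and \<open>Q j n \<le> 3/2 v \<rho> ^ j\<close> for \<open>n > j\<close> are proved simultaneously.
  The tilted moment \<open>Q j n\<close> needs the quadratic covariance inequality itself: the plain one would
  leave an error of order \<open>sqrt v\<close>, which is not dominated by \<open>v\<close>.\<close>

theorem mgf_bernstein:
  assumes mean: "expectation (\<lambda>x. g (U 1 x)) = 0"
    and v: "v = expectation (\<lambda>x. (g (U 1 x))\<^sup>2)"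
    and Psi: "\<And>m. (\<Sum>n\<in>{1..m}. sqrt (\<phi> n)) \<le> Psi"
    and \<theta>: "\<theta> = (1 + Psi)\<^sup>2" and l: "l \<le> 1 / (2 * \<theta>)"
  shows "G n \<le> exp (4 * l\<^sup>2 * \<theta> * v) ^ n"
proof -
  define \<rho> where "\<rho> = exp (4 * l\<^sup>2 * \<theta> * v)"
  have Psi0: "0 \<le> Psi" using Psi[of 0] by simp
  have v0: "0 \<le> v" unfolding v by simp
  have \<theta>1: "1 \<le> \<theta>" unfolding \<theta> using power_mono[of 1 "1 + Psi" 2] Psi0 by simp
  have \<rho>1: "1 \<le> \<rho>" unfolding \<rho>_def using v0 \<theta>1 by simp
  \<comment> \<open>By 4 Psi \<le> (1 + Psi)^2 and l \<le> 1 / (2 \<theta>). The value 1/8 makes the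
    covariance error 4 l v Psi of the tilted second moment at most v/2, which is the origin of the
    constant 3/2.\<close>
  have lPsi: "l * Psi \<le> 1 / 8"
  proof -
    have "0 \<le> (1 - Psi)\<^sup>2" by simp
    then have "4 * Psi \<le> \<theta>" by (simp add: \<theta> power2_eq_square algebra_simps)
    then have "l * (4 * Psi) \<le> 1 / (2 * \<theta>) * \<theta>" using l l_pos Psi0 \<theta>1 by (intro mult_mono) auto
    then show ?thesis using \<theta>1 by simp
  qed
  have Vv: "expectation (\<lambda>x. (V n x)\<^sup>2) = v" if "1 \<le> n" for n
    unfolding v V_def by (rule expectation_ident[OF _ that]) measurable
  have V0: "expectation (V n) = 0" if "1 \<le> n" for n
    using expectation_ident[OF g_measurable that] mean by (simp add: V_def[abs_def])
  \<comment> \<open>The induction hypothesis is a premise because the bound is applied twice: to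
    \<open>g\<close> after j - 1 rounds for \<open>G j\<close>, and to its square after j rounds for
    \<open>Q j n\<close>. Only indices below the number of rounds are asked for, so no circularity
    arises.\<close>
  have bd: "expectation (\<lambda>x. P j x * (F (U n x) - expectation (\<lambda>x. F (U n x)))) \<le> 4 * l * v * Psi * \<rho> ^ j"
    if IH: "\<And>i. i < j \<Longrightarrow> G i \<le> \<rho> ^ i \<and> (\<forall>n>i. Q i n \<le> 3 / 2 * v * \<rho> ^ i)"
      and n: "j < n" and F: "F \<in> borel_measurable borel" and Fg: "\<And>u. \<bar>F u\<bar> \<le> \<bar>g u\<bar>" for j n F
  proof -
    have F1: "\<bar>F u\<bar> \<le> 1" for u using Fg[of u] g_le_1[of u] by linarith
    have bf: "bounded_rv (\<lambda>x. F (U n x))" using n by (intro bounded_rv_U[OF F F1]) simp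
    have step: "expectation (\<lambda>x. P (i - 1) x * X i x * (F (U n x) - expectation (\<lambda>x. F (U n x))))
        \<le> sqrt (\<phi> (n - i)) * (4 * l * v * \<rho> ^ j)" if i: "i \<in> {1..j}" for i
    proof -
      have i': "1 \<le> i" "i < n" "i - 1 < j" "i - 1 < i" "i - 1 < n" "1 \<le> n" using i n by auto
      have "G (i - 1) \<le> \<rho> ^ (i - 1)" "Q (i - 1) i \<le> 3 / 2 * v * \<rho> ^ (i - 1)" "Q (i - 1) n \<le> 3 / 2 * v * \<rho> ^ (i - 1)"
        using IH[OF i'(3)] i' by auto
      moreover from this(1) have "v * G (i - 1) \<le> v * \<rho> ^ (i - 1)" using v0 by (rule mult_left_mono)
      \<comment> \<open>4 = 3/2 + 3/2 + 1: two tilted second moments and one untilted.\<close>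
      ultimately have 1: "Q (i - 1) i + Q (i - 1) n + v * G (i - 1) \<le> 4 * v * \<rho> ^ (i - 1)" by linarith
      have "\<rho> ^ (i - 1) \<le> \<rho> ^ j" using \<rho>1 i by (intro power_increasing) auto
      then have 2: "4 * v * \<rho> ^ (i - 1) \<le> 4 * v * \<rho> ^ j" using v0 by (intro mult_left_mono) auto
      have "expectation (\<lambda>x. P (i - 1) x * X i x * (F (U n x) - expectation (\<lambda>x. F (U n x))))
        \<le> l * sqrt (\<phi> (n - i)) * (Q (i - 1) i + Q (i - 1) n + v * G (i - 1))"
        using step_quad[OF i'(1,2) F Fg] Vv[OF i'(6)] by simp
      also have "\<dots> \<le> l * sqrt (\<phi> (n - i)) * (4 * v * \<rho> ^ j)"
        using 1 2 l_pos phi_nonneg by (intro mult_left_mono) auto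
      finally show ?thesis by (simp add: mult_ac)
    qed
    have "expectation (\<lambda>x. P j x * (F (U n x) - expectation (\<lambda>x. F (U n x))))
        \<le> (\<Sum>i\<in>{1..j}. sqrt (\<phi> (n - i)) * (4 * l * v * \<rho> ^ j))"
      unfolding telescope[OF bf] by (rule sum_mono) (rule step)
    also have "\<dots> = (\<Sum>i\<in>{1..j}. sqrt (\<phi> (n - i))) * (4 * l * v * \<rho> ^ j)"
      by (rule sum_distrib_right[symmetric])
    also have "\<dots> \<le> Psi * (4 * l * v * \<rho> ^ j)"
      using order_trans[OF sum_diff_le_sum[OF n, of "\<lambda>k. sqrt (\<phi> k)"] Psi] phi_nonneg \<rho>1 l_pos v0
      by (intro mult_right_mono) auto
    finally show ?thesis by (simp add: mult_ac)
  qed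
  have "G j \<le> \<rho> ^ j \<and> (\<forall>n>j. Q j n \<le> 3 / 2 * v * \<rho> ^ j)" for j
  proof (induction j rule: less_induct)
    case (less j)
    have Gj: "G j \<le> \<rho> ^ j"
    proof (cases j)
      case 0
      then show ?thesis by (simp add: G_0)
    next
      case (Suc k)
      have k: "k < j" "1 \<le> j" using Suc by auto
      have IH: "G k \<le> \<rho> ^ k" "Q k j \<le> 3 / 2 * v * \<rho> ^ k" using less.IH[OF k(1)] k by auto
      have "expectation (\<lambda>x. P k x * (g (U j x) - expectation (\<lambda>x. g (U j x)))) \<le> 4 * l * v * Psi * \<rho> ^ k"
        by (rule bd) (use less.IH k in auto)
      then have lin: "expectation (\<lambda>x. P k x * V j x) \<le> 4 * l * v * Psi * \<rho> ^ k"
        using V0[OF k(2)] by (simp add: V_def[abs_def])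
      have ints: "integrable M (P k)" "integrable M (\<lambda>x. P k x * V j x)" "integrable M (\<lambda>x. P k x * (V j x)\<^sup>2)"
        "integrable M (P j)"
        by (intro bounded_rv_integrable bounded_rv_intros bounded_rv_P bounded_rv_V k)+
      \<comment> \<open>The second-order bound on exp leaves the first and second tilted moments of
        the new loss. The first is a pure covariance, since \<open>V j\<close> has mean 0, and so it
        is of order l v.\<close>
      have "G j \<le> expectation (\<lambda>x. P k x + l * (P k x * V j x) + l\<^sup>2 * (P k x * (V j x)\<^sup>2))"
        unfolding G_def
      proof (rule integral_mono)
        fix x
        have "l * \<bar>V j x\<bar> \<le> (1/2) * 1" using V_le l_pos l_le by (intro mult_mono) auto
        then have "\<bar>l * V j x\<bar> \<le> 1" using l_pos by (simp add: abs_mult)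
        then have "exp (l * V j x) \<le> 1 + l * V j x + (l * V j x)\<^sup>2"
          by (rule exp_le_quadratic)
        from mult_left_mono[OF this P_pos[THEN less_imp_le, of k x]]
        show "P j x \<le> P k x + l * (P k x * V j x) + l\<^sup>2 * (P k x * (V j x)\<^sup>2)"
          by (simp add: Suc P_Suc algebra_simps power_mult_distrib)
      qed (use ints in auto)
      also have "\<dots> = G k + l * expectation (\<lambda>x. P k x * V j x) + l\<^sup>2 * Q k j"
        using ints by (simp add: G_def Q_def)
      also have "\<dots> \<le> \<rho> ^ k + l * (4 * l * v * Psi * \<rho> ^ k) + l\<^sup>2 * (3 / 2 * v * \<rho> ^ k)"
        using IH lin l_pos by (intro add_mono mult_left_mono) auto
      also have "\<dots> = (1 + l\<^sup>2 * v * (4 * Psi + 3 / 2)) * \<rho> ^ k"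
        by (simp add: algebra_simps power2_eq_square)
      also have "\<dots> \<le> \<rho> * \<rho> ^ k"
      proof (rule mult_right_mono)
        have "4 * Psi + 3 / 2 \<le> 4 * \<theta>" using Psi0 by (simp add: \<theta> power2_eq_square algebra_simps)
        then have "l\<^sup>2 * v * (4 * Psi + 3 / 2) \<le> l\<^sup>2 * v * (4 * \<theta>)" using v0 by (intro mult_left_mono) auto
        then have "1 + l\<^sup>2 * v * (4 * Psi + 3 / 2) \<le> 1 + 4 * l\<^sup>2 * \<theta> * v" by (simp add: mult_ac)
        also have "\<dots> \<le> \<rho>" unfolding \<rho>_def by (rule exp_ge_add_one_self)
        finally show "1 + l\<^sup>2 * v * (4 * Psi + 3 / 2) \<le> \<rho>" .
      qed (use \<rho>1 in simp)
      finally show ?thesis using Suc by simp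
    qed
    have "Q j n \<le> 3 / 2 * v * \<rho> ^ j" if n: "j < n" for n
    proof -
      have n1: "1 \<le> n" using n by simp
      have g2: "\<bar>(g u)\<^sup>2\<bar> \<le> \<bar>g u\<bar>" for u
        using mult_left_mono[OF g_le_1[of u] abs_ge_zero[of "g u"]] by (simp add: power2_eq_square abs_mult)
      have "expectation (\<lambda>x. P j x * ((g (U n x))\<^sup>2 - expectation (\<lambda>x. (g (U n x))\<^sup>2))) \<le> 4 * l * v * Psi * \<rho> ^ j"
        by (rule bd[of j n "\<lambda>u. (g u)\<^sup>2"]) (use less.IH n g2 in auto)
      then have c: "expectation (\<lambda>x. P j x * ((V n x)\<^sup>2 - v)) \<le> 4 * l * v * Psi * \<rho> ^ j"
        using Vv[OF n1] by (simp add: V_def)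
      have ints: "integrable M (P j)" "integrable M (\<lambda>x. P j x * ((V n x)\<^sup>2 - v))"
        by (intro bounded_rv_integrable bounded_rv_intros bounded_rv_P bounded_rv_V n1)+
      have "Q j n = expectation (\<lambda>x. P j x * ((V n x)\<^sup>2 - v) + v * P j x)"
        unfolding Q_def by (rule Bochner_Integration.integral_cong) (auto simp: algebra_simps)
      also have "\<dots> = expectation (\<lambda>x. P j x * ((V n x)\<^sup>2 - v)) + v * G j"
        using ints by (simp add: G_def)
      also have "\<dots> \<le> 4 * l * v * Psi * \<rho> ^ j + v * \<rho> ^ j"
        using c Gj v0 by (intro add_mono mult_left_mono) auto
      also have "\<dots> = 4 * (l * Psi) * (v * \<rho> ^ j) + v * \<rho> ^ j" by (simp add: mult_ac)
      also have "\<dots> \<le> 4 * (1 / 8) * (v * \<rho> ^ j) + v * \<rho> ^ j"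
        using lPsi v0 \<rho>1 by (intro add_mono mult_right_mono mult_left_mono) auto
      finally show ?thesis by simp
    qed
    then show ?case using Gj by blast
  qed
  then show ?thesis by (simp add: \<rho>_def)
qed

end

section \<open>Tail bounds\<close>

context prob_space
begin

lemma chernoff:
  assumes i: "integrable M (\<lambda>x. exp (l * Y x))" and l: "0 < l"
    and G: "expectation (\<lambda>x. exp (l * Y x)) \<le> G"
  shows "prob {x\<in>space M. a \<le> Y x} \<le> exp (- l * a) * G"
proof -
  have "{x\<in>space M. a \<le> Y x} = {x\<in>space M. exp (l * a) \<le> exp (l * Y x)}" using l by auto
  moreover have "prob {x\<in>space M. exp (l * a) \<le> exp (l * Y x)} \<le> expectation (\<lambda>x. exp (l * Y x)) / exp (l * a)"
    by (rule integral_Markov_inequality_measure[OF i, of "{}"]) auto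
  moreover have "\<dots> \<le> G / exp (l * a)" using G by (rule divide_right_mono) simp
  ultimately show ?thesis by (simp add: exp_minus field_simps)
qed

end

text \<open>\<open>v\<close> is an upper bound for the variance, so that the maximum over the
  experts fits each of them and a positive excess may be added. \<sigma> selects the upper or the
  lower tail; \<epsilon> will be half the gap.\<close>

locale unit_interval_process = phi_process +
  fixes \<mu> v \<sigma> \<epsilon> :: real
  assumes unit: "1 \<le> t \<Longrightarrow> AE x in M. 0 \<le> U t x \<and> U t x \<le> 1"
    and \<mu>: "\<mu> = expectation (U 1)" and v: "expectation (\<lambda>x. (U 1 x - \<mu>)\<^sup>2) \<le> v"
    and \<sigma>: "\<sigma> = 1 \<or> \<sigma> = -1"
    and \<epsilon>: "0 < \<epsilon>" "\<epsilon> \<le> 1 / 2"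
begin

text \<open>Clamping makes the almost sure bounds hold everywhere without leaving the \<open>\<sigma>\<close>-algebras
  generated by \<open>U\<close>, so the mixing coefficients are unaffected.\<close>

definition clamped :: "real \<Rightarrow> real" where "clamped u = \<sigma> * (max 0 (min 1 u) - \<mu>)"

lemma mean_bounds: "0 \<le> \<mu>" "\<mu> \<le> 1"
proof -
  have m: "U 1 \<in> borel_measurable M" by (rule U_measurable) simp
  have i: "integrable M (U 1)"
    using unit[of 1] m by (intro integrable_const_bound[where B=1]) auto
  show "0 \<le> \<mu>" unfolding \<mu> using unit[of 1] by (intro integral_nonneg_AE) auto
  have "expectation (U 1) \<le> expectation (\<lambda>_. 1)" using unit[of 1] i by (intro integral_mono_AE) auto
  then show "\<mu> \<le> 1" by (simp add: \<mu> prob_space)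
qed

lemma clamped_measurable: "clamped \<in> borel_measurable borel"
  unfolding clamped_def by measurable

lemma clamped_abs_le: "\<bar>clamped u\<bar> \<le> 1"
  using mean_bounds \<sigma> by (auto simp: clamped_def max_def min_def)

lemma clamped_AE:
  assumes "1 \<le> t"
  shows "AE x in M. clamped (U t x) = \<sigma> * (U t x - \<mu>)"
  using unit[OF assms] by eventually_elim (simp add: clamped_def)

lemma integrable_U: "1 \<le> t \<Longrightarrow> integrable M (U t)"
  using unit[of t] U_measurable[of t] by (intro integrable_const_bound[where B=1]) auto

lemma clamped_mean: "expectation (\<lambda>x. clamped (U 1 x)) = 0"
proof -
  have "expectation (\<lambda>x. clamped (U 1 x)) = expectation (\<lambda>x. \<sigma> * (U 1 x - \<mu>))"
    using clamped_AE[of 1] measurable_compose[OF U_measurable[of 1] clamped_measurable] U_measurable[of 1]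
    by (intro integral_cong_AE) auto
  also have "\<dots> = 0" using integrable_U[of 1] by (simp add: \<mu> prob_space)
  finally show ?thesis .
qed

lemma clamped_variance: "expectation (\<lambda>x. (clamped (U 1 x))\<^sup>2) \<le> v"
proof -
  have "expectation (\<lambda>x. (clamped (U 1 x))\<^sup>2) = expectation (\<lambda>x. (U 1 x - \<mu>)\<^sup>2)"
  proof (rule integral_cong_AE)
    show "AE x in M. (clamped (U 1 x))\<^sup>2 = (U 1 x - \<mu>)\<^sup>2"
      using clamped_AE[OF order_refl] by eventually_elim (use \<sigma> in \<open>auto simp: power_mult_distrib\<close>)
    show "(\<lambda>x. (clamped (U 1 x))\<^sup>2) \<in> borel_measurable M"
      using measurable_compose[OF U_measurable[of 1] clamped_measurable] by simp
    show "(\<lambda>x. (U 1 x - \<mu>)\<^sup>2) \<in> borel_measurable M" using U_measurable[of 1] by simp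
  qed
  then show ?thesis using v by simp
qed

lemma clamped_process: "0 < l \<Longrightarrow> l \<le> 1 / 2 \<Longrightarrow> bounded_phi_process M U clamped l"
  by unfold_locales (use clamped_measurable clamped_abs_le in auto)

lemma variance_nonneg: "0 \<le> v"
  using order_trans[OF Bochner_Integration.integral_nonneg v] by simp

text \<open>Exponential Markov inequality for the clamped sum, which agrees outside a null set with
  the signed centred cumulative loss.\<close>

lemma tail_from_mgf:
  assumes l: "0 < l" "l \<le> 1 / 2" and G: "bounded_phi_process.G M U clamped l t \<le> H"
  shows "prob {x\<in>space M. real t * \<epsilon> \<le> \<sigma> * ((\<Sum>s\<in>{1..t}. U s x) - real t * \<mu>)} \<le> exp (- l * (real t * \<epsilon>)) * H"
proof -
  interpret b: bounded_phi_process M U clamped l by (rule clamped_process[OF l])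
  have ae: "AE x in M. \<forall>s\<in>{1..t}. clamped (U s x) = \<sigma> * (U s x - \<mu>)"
    by (rule AE_finite_allI) (auto intro: clamped_AE)
  have S: "(\<lambda>x. \<Sum>s\<in>{1..t}. b.V s x) \<in> borel_measurable M"
    using b.bounded_rv_V by (intro borel_measurable_sum) (auto simp: bounded_rv_def)
  have "prob {x\<in>space M. real t * \<epsilon> \<le> \<sigma> * ((\<Sum>s\<in>{1..t}. U s x) - real t * \<mu>)}
    \<le> prob {x\<in>space M. real t * \<epsilon> \<le> (\<Sum>s\<in>{1..t}. b.V s x)}"
  proof (rule finite_measure_mono_AE)
    show "AE x in M. x \<in> {x\<in>space M. real t * \<epsilon> \<le> \<sigma> * ((\<Sum>s\<in>{1..t}. U s x) - real t * \<mu>)} \<longrightarrow>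
      x \<in> {x\<in>space M. real t * \<epsilon> \<le> (\<Sum>s\<in>{1..t}. b.V s x)}"
      using ae
    proof eventually_elim
      case (elim x)
      then have "(\<Sum>s\<in>{1..t}. b.V s x) = (\<Sum>s\<in>{1..t}. \<sigma> * (U s x - \<mu>))"
        unfolding b.V_def by (intro sum.cong) auto
      also have "\<dots> = \<sigma> * ((\<Sum>s\<in>{1..t}. U s x) - real t * \<mu>)"
        by (simp add: sum_distrib_left[symmetric] sum_subtractf)
      finally show ?case by simp
    qed
    show "{x\<in>space M. real t * \<epsilon> \<le> (\<Sum>s\<in>{1..t}. b.V s x)} \<in> sets M" using S by measurable
  qed
  also have "\<dots> \<le> exp (- l * (real t * \<epsilon>)) * H"
  proof (rule chernoff[OF _ l(1)])
    show "integrable M (\<lambda>x. exp (l * (\<Sum>s\<in>{1..t}. b.V s x)))"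
      using bounded_rv_integrable[OF b.bounded_rv_P[of t]] by (simp add: b.P_def[abs_def])
    show "expectation (\<lambda>x. exp (l * (\<Sum>s\<in>{1..t}. b.V s x))) \<le> H"
      using G by (simp add: b.G_def b.P_def[abs_def])
  qed
  finally show ?thesis .
qed

section \<open>Tail bounds under mixing\<close>

lemma mixing_hoeffding_tail:
  assumes Phi: "\<And>m. (\<Sum>n\<in>{1..m}. \<phi> n) \<le> Phi" and \<theta>: "\<theta> = 1 + 4 * Phi"
  shows "prob {x\<in>space M. real t * \<epsilon> \<le> \<sigma> * ((\<Sum>s\<in>{1..t}. U s x) - real t * \<mu>)}
    \<le> exp (- (\<epsilon>\<^sup>2 / (2 * \<theta>)) * real t)"
proof -
  have \<theta>1: "1 \<le> \<theta>" using Phi[of 0] \<theta> by simp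
  \<comment> \<open>The minimiser of - l \<epsilon> + l^2 \<theta> / 2; it is at most 1/2 because
    \<epsilon> \<le> 1/2 and \<theta> \<ge> 1.\<close>
  define l where "l = \<epsilon> / \<theta>"
  have l: "0 < l" "l \<le> 1 / 2"
    using \<epsilon> \<theta>1 frac_le[of \<epsilon> "1/2" 1 \<theta>] by (auto simp: l_def)
  interpret b: bounded_phi_process M U clamped l by (rule clamped_process[OF l])
  define a where "a = (if \<sigma> = 1 then - \<mu> else \<mu> - 1)"
  have a: "-1 \<le> a" "a \<le> 0" "a \<le> clamped u" "clamped u \<le> a + 1" for u
    using mean_bounds \<sigma> by (auto simp: a_def clamped_def max_def min_def)
  have "b.G t \<le> exp (l\<^sup>2 * (1 + 4 * Phi) / 2) ^ t"
    by (rule b.mgf_hoeffding[OF a clamped_mean Phi])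
  from tail_from_mgf[OF l this]
  have "prob {x\<in>space M. real t * \<epsilon> \<le> \<sigma> * ((\<Sum>s\<in>{1..t}. U s x) - real t * \<mu>)}
    \<le> exp (- l * (real t * \<epsilon>) + real t * (l\<^sup>2 * \<theta> / 2))"
    by (simp add: exp_of_nat_mult[symmetric] exp_add[symmetric] \<theta>)
  also have "- l * (real t * \<epsilon>) + real t * (l\<^sup>2 * \<theta> / 2) = - (\<epsilon>\<^sup>2 / (2 * \<theta>)) * real t"
    using \<theta>1 by (simp add: l_def field_simps power2_eq_square)
  finally show ?thesis .
qed

lemma mixing_bernstein_tail:
  assumes Psi: "\<And>m. (\<Sum>n\<in>{1..m}. sqrt (\<phi> n)) \<le> Psi" and \<theta>: "\<theta> = (1 + Psi)\<^sup>2"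
  shows "prob {x\<in>space M. real t * \<epsilon> \<le> \<sigma> * ((\<Sum>s\<in>{1..t}. U s x) - real t * \<mu>)}
    \<le> exp (- (\<epsilon>\<^sup>2 / (16 * \<theta> * v + 4 * \<theta> * \<epsilon>)) * real t)"
proof -
  have Psi0: "0 \<le> Psi" using Psi[of 0] by simp
  have \<theta>1: "1 \<le> \<theta>" unfolding \<theta> using power_mono[of 1 "1 + Psi" 2] Psi0 by simp
  note v0 = variance_nonneg
  \<comment> \<open>The summand 2 \<theta> \<epsilon> enforces l \<le> 1 / (2 \<theta>), and 8
    \<theta> v makes the variance term 4 l \<theta> v at most \<epsilon> / 2. What remains per round
    is - l \<epsilon> / 2 = - \<epsilon>^2 / (2 D).\<close>
  define D where "D = 8 * \<theta> * v + 2 * \<theta> * \<epsilon>"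
  have D: "2 * \<theta> * \<epsilon> \<le> D" "0 < D" using \<theta>1 v0 \<epsilon> by (auto simp: D_def intro: add_nonneg_pos)
  define l where "l = \<epsilon> / D"
  have l0: "0 < l" using \<epsilon> D by (simp add: l_def)
  have l\<theta>: "l \<le> 1 / (2 * \<theta>)"
    unfolding l_def using D \<theta>1 \<epsilon> by (simp add: field_simps)
  also have "\<dots> \<le> 1 / 2" using \<theta>1 by simp
  finally have l1: "l \<le> 1 / 2" .
  interpret b: bounded_phi_process M U clamped l by (rule clamped_process[OF l0 l1])
  have "b.G t \<le> exp (4 * l\<^sup>2 * \<theta> * expectation (\<lambda>x. (clamped (U 1 x))\<^sup>2)) ^ t"
    by (rule b.mgf_bernstein[OF clamped_mean refl Psi \<theta> l\<theta>])
  also have "\<dots> \<le> exp (4 * l\<^sup>2 * \<theta> * v) ^ t"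
    using clamped_variance \<theta>1 by (intro power_mono) (auto intro!: mult_left_mono)
  finally have "b.G t \<le> exp (4 * l\<^sup>2 * \<theta> * v) ^ t" .
  from tail_from_mgf[OF l0 l1 this]
  have "prob {x\<in>space M. real t * \<epsilon> \<le> \<sigma> * ((\<Sum>s\<in>{1..t}. U s x) - real t * \<mu>)}
    \<le> exp (real t * (l * (4 * l * \<theta> * v - \<epsilon>)))"
    by (simp add: exp_of_nat_mult[symmetric] exp_add[symmetric] algebra_simps power2_eq_square)
  also have "\<dots> \<le> exp (real t * (l * (- (\<epsilon> / 2))))"
  proof -
    have "4 * l * \<theta> * v = \<epsilon> * (4 * \<theta> * v / D)" by (simp add: l_def)
    also have "\<dots> \<le> \<epsilon> * (1 / 2)" using D \<theta>1 \<epsilon> by (intro mult_left_mono) (auto simp: field_simps D_def)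
    finally have "4 * l * \<theta> * v - \<epsilon> \<le> - (\<epsilon> / 2)" by simp
    then have "real t * (l * (4 * l * \<theta> * v - \<epsilon>)) \<le> real t * (l * (- (\<epsilon> / 2)))"
      using l0 by (intro mult_left_mono) auto
    then show ?thesis by simp
  qed
  also have "real t * (l * (- (\<epsilon> / 2))) = - (\<epsilon>\<^sup>2 / (16 * \<theta> * v + 4 * \<theta> * \<epsilon>)) * real t"
  proof -
    have "16 * \<theta> * v + 4 * \<theta> * \<epsilon> = 2 * D" by (simp add: D_def)
    then show ?thesis by (simp only:) (simp add: l_def power2_eq_square mult_ac)
  qed
  finally show ?thesis .
qed

section \<open>Tail bounds for independent losses\<close>

lemma iid_hoeffding_tail:
  assumes indep: "indep_vars (\<lambda>_. borel) U {1..}" and t: "1 \<le> t"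
  shows "prob {x\<in>space M. real t * \<epsilon> \<le> \<sigma> * ((\<Sum>s\<in>{1..t}. U s x) - real t * \<mu>)}
    \<le> exp (- (2 * \<epsilon>\<^sup>2) * real t)"
proof -
  have E: "expectation (U s) = \<mu>" if "s \<in> {1..t}" for s
    using expectation_ident[of "\<lambda>u. u" s] that by (simp add: \<mu>)
  \<comment> \<open>A meta-equality, because \<open>Hoeffding_ineq\<close> introduces its mean
    parameter by a definition.\<close>
  have mu: "real t * \<mu> \<equiv> (\<Sum>s\<in>{1..t}. expectation (U s))" using E by simp
  interpret h: Hoeffding_ineq M "{1..t}" U "\<lambda>_. 0" "\<lambda>_. 1" "real t * \<mu>"
    by unfold_locales (use unit mu in \<open>auto intro: indep_vars_subset[OF indep]\<close>)
  have e: "- 2 * (real t * \<epsilon>)\<^sup>2 / real t = - (2 * \<epsilon>\<^sup>2) * real t"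
    using t by (simp add: power2_eq_square)
  have te: "0 \<le> real t * \<epsilon>" using \<epsilon> by simp
  show ?thesis
  proof (cases "\<sigma> = 1")
    case True
    have "{x\<in>space M. real t * \<epsilon> \<le> \<sigma> * ((\<Sum>s\<in>{1..t}. U s x) - real t * \<mu>)} =
      {x\<in>space M. real t * \<mu> + real t * \<epsilon> \<le> (\<Sum>s\<in>{1..t}. U s x)}" using True by auto
    then show ?thesis using h.Hoeffding_ineq_ge[OF te] t e by simp
  next
    case False
    then have "{x\<in>space M. real t * \<epsilon> \<le> \<sigma> * ((\<Sum>s\<in>{1..t}. U s x) - real t * \<mu>)} =
      {x\<in>space M. (\<Sum>s\<in>{1..t}. U s x) \<le> real t * \<mu> - real t * \<epsilon>}" using \<sigma> by auto
    then show ?thesis using h.Hoeffding_ineq_le[OF te] t e by simp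
  qed
qed

text \<open>The expectation factorises over the rounds, and in each factor the first-order term
  vanishes by centring. The almost sure bounds are used directly, without clamping.\<close>

lemma iid_bernstein_mgf:
  assumes indep: "indep_vars (\<lambda>_. borel) U {1..}" and l: "0 < l" "l < 3"
  shows "integrable M (\<lambda>x. exp (l * (\<sigma> * ((\<Sum>s\<in>{1..t}. U s x) - real t * \<mu>))))"
    and "expectation (\<lambda>x. exp (l * (\<sigma> * ((\<Sum>s\<in>{1..t}. U s x) - real t * \<mu>))))
      \<le> exp (l\<^sup>2 * v / (2 * (1 - l / 3))) ^ t"
proof -
  define Y where "Y s x = exp (l * (\<sigma> * (U s x - \<mu>)))" for s x
  have eq: "exp (l * (\<sigma> * ((\<Sum>s\<in>{1..t}. U s x) - real t * \<mu>))) = (\<Prod>s\<in>{1..t}. Y s x)" for x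
    unfolding Y_def by (simp add: exp_sum[symmetric] sum_distrib_left[symmetric] sum_subtractf)
  have iU: "indep_vars (\<lambda>_. borel) U {1..t}" by (rule indep_vars_subset[OF indep]) auto
  have iY: "indep_vars (\<lambda>_. borel) Y {1..t}"
    unfolding Y_def by (rule indep_vars_compose2[OF iU]) measurable
  have ae: "AE x in M. \<bar>\<sigma> * (U s x - \<mu>)\<bar> \<le> 1" if "1 \<le> s" for s
    using unit[OF that]
  proof eventually_elim
    case (elim x)
    then show ?case using mean_bounds \<sigma> by auto
  qed
  have Ym: "Y s \<in> borel_measurable M" if "1 \<le> s" for s
    using U_measurable[OF that] unfolding Y_def by measurable
  have intY: "integrable M (Y s)" if "1 \<le> s" for s
  proof (rule integrable_const_bound[where B = "exp l"])
    show "AE x in M. norm (Y s x) \<le> exp l"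
      using ae[OF that]
    proof eventually_elim
      case (elim x)
      then have "l * (\<sigma> * (U s x - \<mu>)) \<le> l * 1" using l by (intro mult_left_mono) auto
      then show ?case by (simp add: Y_def)
    qed
  qed (rule Ym[OF that])
  have EY: "expectation (Y s) \<le> exp (l\<^sup>2 * v / (2 * (1 - l / 3)))" if s: "1 \<le> s" for s
  proof -
    define K where "K = l\<^sup>2 / (2 * (1 - l / 3))"
    have K: "0 \<le> K" using l by (simp add: K_def)
    have Um: "U s \<in> borel_measurable M" by (rule U_measurable[OF s])
    have i2: "integrable M (\<lambda>x. (U s x - \<mu>)\<^sup>2)"
    proof (rule integrable_const_bound[where B = 1])
      show "AE x in M. norm ((U s x - \<mu>)\<^sup>2) \<le> 1"
        using ae[OF s]
      proof eventually_elim
        case (elim x)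
        then have "\<bar>U s x - \<mu>\<bar> \<le> 1" using \<sigma> by auto
        then show ?case by (simp add: abs_square_le_1)
      qed
    qed (use Um in measurable)
    have i1: "integrable M (U s)" by (rule integrable_U[OF s])
    have "expectation (Y s) \<le> expectation (\<lambda>x. 1 + l * \<sigma> * (U s x - \<mu>) + K * (U s x - \<mu>)\<^sup>2)"
    proof (rule integral_mono_AE)
      show "AE x in M. Y s x \<le> 1 + l * \<sigma> * (U s x - \<mu>) + K * (U s x - \<mu>)\<^sup>2"
        using ae[OF s]
      proof eventually_elim
        case (elim x)
        define y where "y = l * (\<sigma> * (U s x - \<mu>))"
        have yl: "\<bar>y\<bar> \<le> l" using elim l mult_left_mono[OF elim, of l] by (simp add: y_def abs_mult)
        have y2: "y\<^sup>2 = l\<^sup>2 * (U s x - \<mu>)\<^sup>2" using \<sigma> by (auto simp: y_def power_mult_distrib)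
        have "exp y \<le> 1 + y + y\<^sup>2 / (2 * (1 - \<bar>y\<bar> / 3))" by (rule exp_le_bernstein) (use yl l in simp)
        also have "y\<^sup>2 / (2 * (1 - \<bar>y\<bar> / 3)) \<le> y\<^sup>2 / (2 * (1 - l / 3))"
          using yl l by (intro divide_left_mono) (auto intro!: mult_pos_pos)
        finally show ?case by (simp add: Y_def y_def[symmetric] y2 K_def) (simp add: y_def mult_ac)
      qed
    qed (use intY[OF s] i1 i2 in auto)
    also have "\<dots> = 1 + l * \<sigma> * (expectation (U s) - \<mu>) + K * expectation (\<lambda>x. (U s x - \<mu>)\<^sup>2)"
      using i1 i2 by (simp add: prob_space)
    also have "\<dots> = 1 + K * expectation (\<lambda>x. (U 1 x - \<mu>)\<^sup>2)"
      using expectation_ident[of "\<lambda>u. u" s] expectation_ident[of "\<lambda>u. (u - \<mu>)\<^sup>2" s] s by (simp add: \<mu>)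
    also have "\<dots> \<le> 1 + K * v" using v K by (intro add_mono mult_left_mono) auto
    also have "\<dots> \<le> exp (K * v)" by (rule exp_ge_add_one_self)
    finally show ?thesis by (simp add: K_def)
  qed
  show "integrable M (\<lambda>x. exp (l * (\<sigma> * ((\<Sum>s\<in>{1..t}. U s x) - real t * \<mu>))))"
    unfolding eq by (rule indep_vars_integrable) (use iY intY in auto)
  have "expectation (\<lambda>x. exp (l * (\<sigma> * ((\<Sum>s\<in>{1..t}. U s x) - real t * \<mu>)))) = (\<Prod>s\<in>{1..t}. expectation (Y s))"
    unfolding eq by (rule indep_vars_lebesgue_integral) (use iY intY in auto)
  also have "\<dots> \<le> (\<Prod>s\<in>{1..t}. exp (l\<^sup>2 * v / (2 * (1 - l / 3))))"
    by (rule prod_mono) (use EY in \<open>auto intro!: Bochner_Integration.integral_nonneg simp: Y_def\<close>)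
  finally show "expectation (\<lambda>x. exp (l * (\<sigma> * ((\<Sum>s\<in>{1..t}. U s x) - real t * \<mu>))))
      \<le> exp (l\<^sup>2 * v / (2 * (1 - l / 3))) ^ t" by simp
qed

lemma iid_bernstein_tail_pos:
  assumes indep: "indep_vars (\<lambda>_. borel) U {1..}" and vpos: "0 < v"
  shows "prob {x\<in>space M. real t * \<epsilon> \<le> \<sigma> * ((\<Sum>s\<in>{1..t}. U s x) - real t * \<mu>)}
    \<le> exp (- (\<epsilon>\<^sup>2 / (2 * v + 2 / 3 * \<epsilon>)) * real t)"
proof -
  define D where "D = v + \<epsilon> / 3"
  have D: "0 < D" using vpos \<epsilon> by (simp add: D_def)
  \<comment> \<open>Bernstein's choice: 1 - l / 3 becomes v / D, so the generating function costs l
    \<epsilon> / 2 per round, half of what the Markov factor gains. A positive v keeps l below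
    3.\<close>
  define l where "l = \<epsilon> / D"
  have l: "0 < l" "l < 3" using D \<epsilon> vpos by (auto simp: l_def field_simps D_def)
  have "1 - l / 3 = v / D" using D by (simp add: l_def field_simps) (simp add: D_def algebra_simps)
  then have K: "l\<^sup>2 * v / (2 * (1 - l / 3)) = l * \<epsilon> / 2"
    using D vpos by (simp add: l_def power2_eq_square)
  have "prob {x\<in>space M. real t * \<epsilon> \<le> \<sigma> * ((\<Sum>s\<in>{1..t}. U s x) - real t * \<mu>)}
    \<le> exp (- l * (real t * \<epsilon>)) * exp (l * \<epsilon> / 2) ^ t"
    by (rule chernoff[OF iid_bernstein_mgf(1)[OF indep l] l(1) iid_bernstein_mgf(2)[OF indep l, unfolded K]])
  also have "\<dots> = exp (- (l * \<epsilon> / 2) * real t)"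
    by (simp add: exp_of_nat_mult[symmetric] exp_add[symmetric] algebra_simps)
  also have "l * \<epsilon> / 2 = \<epsilon>\<^sup>2 / (2 * v + 2 / 3 * \<epsilon>)"
  proof -
    have "2 * v + 2 / 3 * \<epsilon> = 2 * D" by (simp add: D_def)
    then show ?thesis by (simp only:) (simp add: l_def power2_eq_square)
  qed
  finally show ?thesis .
qed

text \<open>For v = 0 the parameter l would be 3, outside the admissible range; so the bound for v +
  d is taken to the limit as d decreases to 0.\<close>

lemma iid_bernstein_tail:
  assumes indep: "indep_vars (\<lambda>_. borel) U {1..}"
  shows "prob {x\<in>space M. real t * \<epsilon> \<le> \<sigma> * ((\<Sum>s\<in>{1..t}. U s x) - real t * \<mu>)}
    \<le> exp (- (\<epsilon>\<^sup>2 / (2 * v + 2 / 3 * \<epsilon>)) * real t)" (is "?p \<le> _")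
proof -
  have le: "?p \<le> exp (- (\<epsilon>\<^sup>2 / (2 * (v + d) + 2 / 3 * \<epsilon>)) * real t)" if d: "0 < d" for d
  proof -
    interpret d: unit_interval_process M U \<mu> "v + d" \<sigma> \<epsilon>
      by unfold_locales (use unit \<mu> v \<sigma> \<epsilon> d in auto)
    show ?thesis using d.iid_bernstein_tail_pos[OF indep] variance_nonneg d by simp
  qed
  have "((\<lambda>d. exp (- (\<epsilon>\<^sup>2 / (2 * (v + d) + 2 / 3 * \<epsilon>)) * real t)) \<longlongrightarrow>
      exp (- (\<epsilon>\<^sup>2 / (2 * (v + 0) + 2 / 3 * \<epsilon>)) * real t)) (at_right 0)"
    using variance_nonneg \<epsilon> by (intro tendsto_intros) auto
  moreover have "eventually (\<lambda>d. ?p \<le> exp (- (\<epsilon>\<^sup>2 / (2 * (v + d) + 2 / 3 * \<epsilon>)) * real t)) (at_right 0)"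
    using le by (intro eventually_at_right_less[THEN eventually_mono]) auto
  ultimately show ?thesis using tendsto_lowerbound[of _ _ "at_right (0::real)" ?p] by simp
qed

end

section \<open>Regret of follow-the-leader\<close>

text \<open>\<open>lead t\<close> is the leader after round \<open>t\<close>, i.e. the expert followed in round \<open>t + 1\<close>.  The term
  \<open>of_bool (lead T \<noteq> ks)\<close> of the invariant pays for the step that starts an excursion from \<open>ks\<close>; when
  the excursion ends, comparison with \<open>ks\<close> alone recovers it.\<close>

lemma leader_regret:
  fixes x L :: "nat \<Rightarrow> nat \<Rightarrow> real" and A :: "nat \<Rightarrow> real" and lead :: "nat \<Rightarrow> nat"
  assumes x: "\<And>t k. 1 \<le> t \<Longrightarrow> k < K \<Longrightarrow> 0 \<le> x t k \<and> x t k \<le> 1"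
    and L0: "\<And>k. L 0 k = 0" and LS: "\<And>t k. L (Suc t) k = L t k + x (Suc t) k"
    and lead: "\<And>t. 1 \<le> t \<Longrightarrow> lead t < K" "\<And>t k. 1 \<le> t \<Longrightarrow> k < K \<Longrightarrow> L t (lead t) \<le> L t k"
    and ks: "ks < K"
    and A1: "A 1 \<le> 1" and A: "\<And>t. 1 \<le> t \<Longrightarrow> A (Suc t) = x (Suc t) (lead t)"
  defines "N \<equiv> \<lambda>T. \<Sum>t\<in>{1..<T}. of_bool (lead t \<noteq> ks) :: real"
  assumes T: "1 \<le> T"
  shows "(\<Sum>t\<in>{1..T}. A t) - L T (lead T) \<le> 2 + N T"
proof -
  have N1: "N (Suc T) = N T + of_bool (lead T \<noteq> ks)" if "1 \<le> T" for T
    unfolding N_def using that by (rule sum.atLeastLessThan_Suc)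
  have "(\<Sum>t\<in>{1..T}. A t) - L T ks \<le> 1 + N T \<and>
    (\<Sum>t\<in>{1..T}. A t) - L T (lead T) \<le> 1 + N T + of_bool (lead T \<noteq> ks)"
    using T
  proof (induction T rule: dec_induct)
    case base
    have "0 \<le> L 1 k" if "k < K" for k using x[of 1 k] that L0[of k] LS[of 0 k] by simp
    from this[OF ks] this[OF lead(1)[OF order_refl]] show ?case
      using A1 by (auto simp: N_def)
  next
    case (step T)
    let ?S = "\<Sum>t\<in>{1..T}. A t" and ?a = "lead T" and ?b = "lead (Suc T)"
    have T: "1 \<le> T" using step by simp
    have b: "?b < K" "?a < K" using lead(1) T by auto
    have la: "x (Suc T) ?a \<le> 1" "0 \<le> x (Suc T) ?b" "0 \<le> x (Suc T) ks" using x b ks by auto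
    have S: "(\<Sum>t\<in>{1..Suc T}. A t) = ?S + x (Suc T) ?a" using A[OF T] by simp
    \<comment> \<open>While \<open>ks\<close> leads, the difference to \<open>ks\<close> does not
      change; otherwise it grows by at most 1, which the new term of \<open>N\<close> pays.\<close>
    have 1: "(\<Sum>t\<in>{1..Suc T}. A t) - L (Suc T) ks \<le> 1 + N (Suc T)"
    proof (cases "?a = ks")
      case True
      then show ?thesis using step.IH S LS[of T ks] N1[OF T] by simp
    next
      case False
      then show ?thesis using step.IH S LS[of T ks] N1[OF T] la by simp
    qed
    moreover have "(\<Sum>t\<in>{1..Suc T}. A t) - L (Suc T) ?b \<le> 1 + N (Suc T) + of_bool (?b \<noteq> ks)"
    proof (cases "?b = ks")
      case True
      then show ?thesis using 1 by simp
    next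
      case False
      \<comment> \<open>Up to round T the change of comparator is free, the old leader having the
        smaller cumulative loss. The unit of the new round is matched by the indicator at
        \<open>?b\<close>, while the indicator at \<open>?a\<close> has become the last term of
        \<open>N\<close>.\<close>
      have "L T ?a \<le> L T ?b" by (rule lead(2)[OF T b(1)])
      then have "(\<Sum>t\<in>{1..Suc T}. A t) - L (Suc T) ?b \<le> ?S - L T ?a + 1"
        using S LS[of T ?b] la by linarith
      also have "\<dots> \<le> 1 + N (Suc T) + of_bool (?b \<noteq> ks)" using step.IH False N1[OF T] by simp
      finally show ?thesis .
    qed
    ultimately show ?case by blast
  qed
  then show ?thesis by (auto split: if_splits simp: of_bool_def)
qed

text \<open>Replaces the leader count by events that do not name the leader: without ties, another
  expert leads only if some expert is strictly ahead of \<open>kstar\<close>. In round 1 all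
  cumulative losses are 0, so the weights are uniform and the loss is at most 1; uniqueness is
  therefore assumed from round 2 on.\<close>

lemma ftl_regret_le:
  assumes K: "2 \<le> K" "kstar < K" and T: "1 \<le> T"
    and X: "\<And>t k. 1 \<le> t \<Longrightarrow> k < K \<Longrightarrow> 0 \<le> X t k w \<and> X t k w \<le> 1"
    and card: "\<And>t. 2 \<le> t \<Longrightarrow> card (ftl_set K X t w) = 1"
  shows "ftl_regret K X T w \<le>
    2 + (\<Sum>t\<in>{1..<T}. of_bool (\<exists>j<K. cumloss X t j w < cumloss X t kstar w))"
proof -
  define L where "L t k = cumloss X t k w" for t k
  define A where "A t = (\<Sum>k<K. ftl_weight K X t k w * X t k w)" for t
  have "\<exists>k. ftl_set K X (Suc t) w = {k}" if "1 \<le> t" for t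
    using card[of "Suc t"] that card_1_singletonE by fastforce
  then obtain lead where lead: "\<And>t. 1 \<le> t \<Longrightarrow> ftl_set K X (Suc t) w = {lead t}" by metis
  have lK: "lead t < K" and lL: "k < K \<Longrightarrow> L t (lead t) \<le> L t k" if "1 \<le> t" for t k
    using lead[OF that] by (auto simp: ftl_set_def L_def)
  have ex: "\<exists>j<K. cumloss X t j w < cumloss X t kstar w" if t: "1 \<le> t" and "lead t \<noteq> kstar" for t
  proof -
    have "kstar \<notin> ftl_set K X (Suc t) w" using lead[OF t] that by auto
    then show ?thesis using K by (auto simp: ftl_set_def not_le)
  qed
  have A_eq: "A (Suc t) = X (Suc t) (lead t) w" if t: "1 \<le> t" for t
  proof -
    have "A (Suc t) = (\<Sum>k<K. if k = lead t then X (Suc t) k w else 0)"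
      unfolding A_def ftl_weight_def lead[OF t] by (rule sum.cong) auto
    then show ?thesis using lK[OF t] by simp
  qed
  have A1: "A 1 \<le> 1"
  proof -
    have s: "ftl_set K X 1 w = {..<K}" by (auto simp: ftl_set_def cumloss_def)
    have "A 1 \<le> (\<Sum>k<K. 1 / real K)"
      unfolding A_def ftl_weight_def s using X[of 1] by (intro sum_mono) (auto intro!: divide_right_mono)
    then show ?thesis using K by simp
  qed
  have "(\<Sum>t\<in>{1..T}. A t) - L T (lead T) \<le> 2 + (\<Sum>t\<in>{1..<T}. of_bool (lead t \<noteq> kstar))"
    by (rule leader_regret[where K = K and x = "\<lambda>t k. X t k w"])
      (use X lK lL K A1 A_eq T in \<open>auto simp: L_def cumloss_def\<close>)
  also have "(\<Sum>t\<in>{1..<T}. of_bool (lead t \<noteq> kstar) :: real) \<le>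
      (\<Sum>t\<in>{1..<T}. of_bool (\<exists>j<K. cumloss X t j w < cumloss X t kstar w))"
    using ex by (intro sum_mono) (auto simp: of_bool_def)
  finally have 1: "(\<Sum>t\<in>{1..T}. A t) - L T (lead T) \<le>
    2 + (\<Sum>t\<in>{1..<T}. of_bool (\<exists>j<K. cumloss X t j w < cumloss X t kstar w))" by simp
  have "Min ((\<lambda>k. cumloss X T k w) ` {..<K}) = L T (lead T)"
    using lK[OF T] lL[OF T] by (intro Min_eqI) (auto simp: L_def)
  then show ?thesis using 1 by (simp add: ftl_regret_def A_def)
qed

text \<open>Up to m, the value ln K / c rounded up, each term is at most 1; beyond m the terms lie
  below a geometric series of ratio exp (- c) with sum at most 1 / c. Rounding costs 1 \<le> 1 / c,
  hence the 2 and the hypothesis c \<le> 1.\<close>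

lemma sum_min_exp_le:
  fixes c K :: real and q :: "nat \<Rightarrow> real"
  assumes c: "0 < c" "c \<le> 1" and K: "1 \<le> K"
    and q: "\<And>t. 1 \<le> t \<Longrightarrow> q t \<le> 1" "\<And>t. 1 \<le> t \<Longrightarrow> q t \<le> K * exp (- c * real t)"
  shows "(\<Sum>t\<in>{1..<T}. q t) \<le> (ln K + 2) / c"
proof -
  define m where "m = nat \<lceil>ln K / c\<rceil>"
  have x0: "0 \<le> ln K / c" using c K by simp
  have m: "ln K / c \<le> real m" "real m \<le> ln K / c + 1"
    unfolding m_def using x0 by linarith+
  have Km: "K \<le> exp (c * real m)"
  proof -
    have "ln K \<le> c * real m" using m(1) c by (simp add: field_simps)
    then have "exp (ln K) \<le> exp (c * real m)" by simp
    then show ?thesis using K by simp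
  qed
  define r where "r = exp (- c)"
  have r: "0 < r" "r < 1" using c by (auto simp: r_def)
  have "q t \<le> of_bool (t \<le> m) + of_bool (m < t) * r ^ (t - m)" if t: "t \<in> {1..<T}" for t
  proof (cases "t \<le> m")
    case True
    then show ?thesis using q(1)[of t] t by simp
  next
    case False
    have "q t \<le> K * exp (- c * real t)" using q(2)[of t] t by simp
    also have "\<dots> \<le> exp (c * real m) * exp (- c * real t)" using Km by (intro mult_right_mono) auto
    also have "\<dots> = r ^ (t - m)"
      using False by (simp add: r_def exp_of_nat_mult[symmetric] exp_add[symmetric] of_nat_diff algebra_simps)
    finally show ?thesis using False by simp
  qed
  then have "(\<Sum>t\<in>{1..<T}. q t) \<le> (\<Sum>t\<in>{1..<T}. of_bool (t \<le> m) + of_bool (m < t) * r ^ (t - m))"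
    by (rule sum_mono)
  \<comment> \<open>The range is enlarged to m + T so that the split at m is possible also for T
    \<le> m.\<close>
  also have "\<dots> \<le> (\<Sum>t\<in>{1..m+T}. of_bool (t \<le> m) + of_bool (m < t) * r ^ (t - m))"
    using r by (intro sum_mono2) auto
  also have "\<dots> = (\<Sum>t\<in>{1..m}. of_bool (t \<le> m) + of_bool (m < t) * r ^ (t - m)) +
      (\<Sum>t\<in>{m+1..m+T}. of_bool (t \<le> m) + of_bool (m < t) * r ^ (t - m))"
    by (rule sum.ub_add_nat) simp
  also have "(\<Sum>t\<in>{1..m}. of_bool (t \<le> m) + of_bool (m < t) * r ^ (t - m)) = real m"
    by simp
  also have "(\<Sum>t\<in>{m+1..m+T}. of_bool (t \<le> m) + of_bool (m < t) * r ^ (t - m)) = (\<Sum>i\<in>{1..T}. r ^ i)"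
    by (rule sum.reindex_bij_witness[of _ "\<lambda>i. i + m" "\<lambda>t. t - m"]) auto
  also have "(\<Sum>i\<in>{1..T}. r ^ i) \<le> 1 / c"
  proof -
    have "(\<Sum>i\<in>{1..T}. r ^ i) = r * (\<Sum>i<T. r ^ i)"
      by (simp add: sum_distrib_left sum.atLeast1_atMost_eq)
    also have "(\<Sum>i<T. r ^ i) = (1 - r ^ T) / (1 - r)" using r by (simp add: sum_gp_strict)
    also have "r * ((1 - r ^ T) / (1 - r)) \<le> r * (1 / (1 - r))"
      using r by (intro mult_left_mono divide_right_mono) auto
    also have "\<dots> \<le> 1 / c"
    proof -
      have "1 + c \<le> exp c" by (rule exp_ge_add_one_self)
      then have "r * (1 + c) \<le> r * exp c" using r by (intro mult_left_mono) auto
      also have "r * exp c = 1" by (simp add: r_def exp_add[symmetric])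
      finally show ?thesis using r c by (simp add: field_simps)
    qed
    finally show ?thesis .
  qed
  finally have "(\<Sum>t\<in>{1..<T}. q t) \<le> real m + 1 / c" by simp
  also have "\<dots> \<le> ln K / c + 1 / c + 1 / c"
  proof -
    have "1 \<le> 1 / c" using c by simp
    then show ?thesis using m(2) by linarith
  qed
  also have "\<dots> = (ln K + 2) / c" by (simp add: add_divide_distrib)
  finally show ?thesis .
qed

context prob_space
begin

lemma expected_ftl_regret_le:
  fixes X :: "nat \<Rightarrow> nat \<Rightarrow> 'a \<Rightarrow> real"
  assumes K: "2 \<le> K" "kstar < K" and T: "1 \<le> T"
    and meas: "\<And>t k. 1 \<le> t \<Longrightarrow> k < K \<Longrightarrow> X t k \<in> borel_measurable M"
    and bd: "\<And>t k. 1 \<le> t \<Longrightarrow> k < K \<Longrightarrow> AE w in M. 0 \<le> X t k w \<and> X t k w \<le> 1"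
    and card: "AE w in M. \<forall>t\<ge>2. card (ftl_set K X t w) = 1"
    and gap: "\<And>k. k < K \<Longrightarrow> k \<noteq> kstar \<Longrightarrow> 2 * \<epsilon> \<le> \<mu> k - \<mu> kstar"
    and c: "0 < c" "c \<le> 1"
    and tail: "\<And>k t \<sigma>. k < K \<Longrightarrow> 1 \<le> t \<Longrightarrow> \<sigma> = 1 \<or> \<sigma> = - 1 \<Longrightarrow>
      prob {w\<in>space M. real t * \<epsilon> \<le> \<sigma> * ((\<Sum>s\<in>{1..t}. X s k w) - real t * \<mu> k)} \<le> exp (- c * real t)"
  shows "expectation (ftl_regret K X T) \<le> 2 + (ln (real K) + 2) / c"
proof -
  define B where "B t = {w\<in>space M. \<exists>j<K. cumloss X t j w < cumloss X t kstar w}" for t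
  have cm: "cumloss X t k \<in> borel_measurable M" if "k < K" for t k
    unfolding cumloss_def[abs_def] using meas that by (intro borel_measurable_sum) auto
  \<comment> \<open>One tail per expert suffices: \<open>kstar\<close> exceeds its mean or a
    competitor falls below its own. So the union bound has K events and not 2 K.\<close>
  define \<sigma> where "\<sigma> k = (if k = kstar then 1 else - 1 :: real)" for k
  define E where "E t k = {w\<in>space M. real t * \<epsilon> \<le> \<sigma> k * (cumloss X t k w - real t * \<mu> k)}" for t k
  have Em: "E t k \<in> sets M" if "k < K" for t k
    using cm[OF that, of t] unfolding E_def by measurable
  have Bm: "B t \<in> sets M" for t
  proof -
    have "B t = (\<Union>j\<in>{..<K}. {w\<in>space M. cumloss X t j w < cumloss X t kstar w})" by (auto simp: B_def)
    also have "\<dots> \<in> sets M"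
      using cm K(2) by (intro sets.finite_UN borel_measurable_less) auto
    finally show ?thesis .
  qed
  have BE: "B t \<subseteq> (\<Union>k<K. E t k)" for t
  proof
    fix w assume "w \<in> B t"
    then obtain j where w: "w \<in> space M" and j: "j < K" "cumloss X t j w < cumloss X t kstar w" by (auto simp: B_def)
    then have jk: "j \<noteq> kstar" by auto
    have "real t * (2 * \<epsilon>) \<le> real t * (\<mu> j - \<mu> kstar)" using gap[OF j(1) jk] by (intro mult_left_mono) auto
    then have "real t * \<epsilon> + real t * \<epsilon> \<le> real t * \<mu> j - real t * \<mu> kstar" by (simp add: algebra_simps)
    then have "real t * \<epsilon> \<le> real t * \<mu> j - cumloss X t j w \<or> real t * \<epsilon> \<le> cumloss X t kstar w - real t * \<mu> kstar"
      using j(2) by linarith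
    then have "w \<in> E t j \<or> w \<in> E t kstar" using w jk by (auto simp: E_def \<sigma>_def)
    then show "w \<in> (\<Union>k<K. E t k)" using j K by auto
  qed
  have pB: "prob (B t) \<le> real K * exp (- c * real t)" if t: "1 \<le> t" for t
  proof -
    have "prob (B t) \<le> prob (\<Union>k\<in>{..<K}. E t k)" using BE Em by (intro finite_measure_mono) auto
    also have "\<dots> \<le> (\<Sum>k<K. prob (E t k))" using Em by (intro finite_measure_subadditive_finite) auto
    also have "\<dots> \<le> (\<Sum>k<K. exp (- c * real t))"
      unfolding E_def cumloss_def using t by (intro sum_mono tail) (auto simp: \<sigma>_def)
    finally show ?thesis by simp
  qed
  have ae: "AE w in M. \<forall>t. \<forall>k\<in>{..<K}. 1 \<le> t \<longrightarrow> 0 \<le> X t k w \<and> X t k w \<le> 1"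
    unfolding AE_all_countable
  proof (intro allI AE_finite_allI)
    fix t k assume k: "k \<in> {..<K}"
    show "AE w in M. 1 \<le> t \<longrightarrow> 0 \<le> X t k w \<and> X t k w \<le> 1"
    proof (cases "1 \<le> t")
      case True
      then have "AE w in M. 0 \<le> X t k w \<and> X t k w \<le> 1" using k by (intro bd) auto
      then show ?thesis by eventually_elim simp
    qed simp
  qed simp
  let ?F = "\<lambda>w. 2 + (\<Sum>t\<in>{1..<T}. indicator (B t) w) :: real"
  have "expectation (ftl_regret K X T) \<le> expectation ?F"
  \<comment> \<open>This rule asks for integrability and nonnegativity of the majorant only; a
    regret that is not integrable would have integral 0.\<close>
  proof (rule integral_mono_AE')
    show "integrable M ?F" using Bm by (auto simp: integrable_indicator_iff less_top[symmetric])
    show "AE w in M. ftl_regret K X T w \<le> ?F w"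
      using ae card AE_space
    proof eventually_elim
      case (elim w)
      have "ftl_regret K X T w \<le> 2 + (\<Sum>t\<in>{1..<T}. of_bool (\<exists>j<K. cumloss X t j w < cumloss X t kstar w))"
        using elim by (intro ftl_regret_le K T) auto
      also have "\<dots> = ?F w" using elim(3) by (auto simp: B_def of_bool_def indicator_def intro!: sum.cong)
      finally show ?case .
    qed
  qed (auto intro!: AE_I2 add_nonneg_nonneg sum_nonneg)
  also have "expectation ?F = 2 + (\<Sum>t\<in>{1..<T}. prob (B t))"
  proof -
    have "integrable M (indicator (B t) :: 'a \<Rightarrow> real)" for t
      using Bm by (simp add: integrable_indicator_iff less_top[symmetric])
    then show ?thesis using Bm by (simp add: prob_space)
  qed
  also have "(\<Sum>t\<in>{1..<T}. prob (B t)) \<le> (ln (real K) + 2) / c"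
    by (rule sum_min_exp_le[OF c]) (use K pB in auto)
  finally show ?thesis by simp
qed

end

section \<open>From stationarity and independence to the four explicit bounds\<close>

lemma strictly_stationary_ident_distr:
  assumes st: "strictly_stationary M U" and meas: "\<And>t. 1 \<le> t \<Longrightarrow> U t \<in> borel_measurable M" and t: "1 \<le> t"
  shows "distr M borel (U t) = distr M borel (U 1)"
proof -
  let ?P = "Pi\<^sub>M {..<1::nat} (\<lambda>_. borel :: real measure)"
  let ?V = "\<lambda>t w. \<lambda>i\<in>{..<1::nat}. U (t + i) w"
  have m: "?V t \<in> measurable M ?P" if "1 \<le> t" for t
    using meas that by (intro measurable_restrict) auto
  have c: "(\<lambda>f. f 0) \<in> measurable ?P borel" by (rule measurable_component_singleton) simp
  have d: "distr M borel (U t) = distr (distr M ?P (?V t)) borel (\<lambda>f. f 0)" if "1 \<le> t" for t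
    by (subst distr_distr[OF c m[OF that]]) (simp add: comp_def)
  have "distr M ?P (?V t) = distr M ?P (?V 1)"
    using st t unfolding strictly_stationary_def by blast
  then show ?thesis using d[OF t] d[of 1] by simp
qed

text \<open>Each bound comes from 2 + (ln K + 2) / c with the rate c of a tail bound at \<epsilon> =
  \<Delta> / 2: \<Delta>^2 / 2 and \<Delta>^2 / (8 v + 4 \<Delta> / 3) for independent losses,
  \<Delta>^2 / (8 \<theta>) and \<Delta>^2 / (8 \<eta> (8 v + \<Delta>)) under mixing, where
  \<theta> is \<open>thetaH_max\<close> and \<eta> is \<open>thetaB_max\<close>. The second and
  third stated bounds are larger than this and follow by monotonicity.\<close>

theorem theorem1:
  fixes M :: "'a measure" and X :: "nat \<Rightarrow> nat \<Rightarrow> 'a \<Rightarrow> real"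
    and K kstar T :: nat
  assumes "prob_space M"
    and "2 \<le> K"
    and "\<forall>t\<ge>1. \<forall>k<K. X t k \<in> borel_measurable M"
    and "\<forall>t\<ge>1. \<forall>k<K. AE w in M. 0 \<le> X t k w \<and> X t k w \<le> 1"
    and "kstar < K"
    and "\<forall>k<K. loss_mean M X kstar \<le> loss_mean M X k"
    and "gap M X K kstar > 0"
    and "AE w in M. \<forall>t\<ge>2. card (ftl_set K X t w) = 1"
    and "1 \<le> T"
  shows
   "((\<forall>k<K. iid_seq M (\<lambda>t. X t k)) \<longrightarrow>
       integral\<^sup>L M (ftl_regret K X T)
         \<le> min (2 + (2 * ln (real K) + 4) / (gap M X K kstar)\<^sup>2)
                (2 + (8 * vmax M X K + 4 / 3 * gap M X K kstar) * (ln (2 * real K) + 2)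
                      / (gap M X K kstar)\<^sup>2))
    \<and> (((\<forall>k<K. strictly_stationary M (\<lambda>t. X t k) \<and> phi_mixing M (\<lambda>t. X t k))
         \<and> (\<exists>C::real. \<forall>k<K. summable (\<lambda>n. sqrt (phi_mix_coeff M (\<lambda>t. X t k) (Suc n)))
               \<and> (\<Sum>n. sqrt (phi_mix_coeff M (\<lambda>t. X t k) (Suc n))) < C)) \<longrightarrow>
       integral\<^sup>L M (ftl_regret K X T)
         \<le> min (3 + 8 * thetaH_max M X K * (ln (real K) + 4) / (gap M X K kstar)\<^sup>2)
                (2 + 8 * thetaB_max M X K * (8 * vmax M X K + gap M X K kstar) * (ln (real K) + 2)
                      / (gap M X K kstar)\<^sup>2))"
proof -
  interpret prob_space M by fact
  note K = \<open>2 \<le> K\<close>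
  define \<Delta> where "\<Delta> = gap M X K kstar"
  define \<mu> where "\<mu> k = loss_mean M X k" for k
  define v where "v = vmax M X K"
  have \<Delta>0: "0 < \<Delta>" using assms(7) by (simp add: \<Delta>_def)
  have gap: "\<Delta> \<le> \<mu> k - \<mu> kstar" if "k < K" "k \<noteq> kstar" for k
    unfolding \<Delta>_def gap_def \<mu>_def using that by (intro Min_le) auto
  have int: "integrable M (X 1 k)" if k: "k < K" for k
  proof (rule integrable_const_bound[where B = 1])
    have "AE w in M. 0 \<le> X 1 k w \<and> X 1 k w \<le> 1" using assms(4) k by blast
    then show "AE w in M. norm (X 1 k w) \<le> 1" by eventually_elim simp
  qed (use assms(3) k in blast)
  have \<mu>01: "0 \<le> \<mu> k" "\<mu> k \<le> 1" if k: "k < K" for k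
  proof -
    have b: "AE w in M. 0 \<le> X 1 k w \<and> X 1 k w \<le> 1" using assms(4) k by blast
    then show "0 \<le> \<mu> k" unfolding \<mu>_def loss_mean_def by (intro integral_nonneg_AE) auto
    have "expectation (X 1 k) \<le> expectation (\<lambda>_. 1)" using b int[OF k] by (intro integral_mono_AE) auto
    then show "\<mu> k \<le> 1" by (simp add: \<mu>_def loss_mean_def prob_space)
  qed
  \<comment> \<open>A competitor exists since K \<ge> 2; two means in the unit interval then bound
    the gap by 1, which gives both \<epsilon> \<le> 1/2 and c \<le> 1.\<close>
  obtain k' where "k' < K" "k' \<noteq> kstar"
    by (rule that[of "if kstar = 0 then 1 else 0"]) (use K in auto)
  then have \<Delta>1: "\<Delta> \<le> 1" using gap[of k'] \<mu>01[of k'] \<mu>01[OF assms(5)] by linarith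
  have var: "loss_var M X k \<le> v" if "k < K" for k
    unfolding v_def vmax_def using that by (intro Max_ge) auto
  have v0: "0 \<le> v"
    using order_trans[OF _ var[OF assms(5)]] by (simp add: loss_var_def)
  have process: "unit_interval_process M (\<lambda>t. X t k) (\<mu> k) v \<sigma> (\<Delta> / 2)"
    if k: "k < K" and \<sigma>: "\<sigma> = 1 \<or> \<sigma> = - 1"
      and id: "\<And>t. 1 \<le> t \<Longrightarrow> distr M borel (X t k) = distr M borel (X 1 k)" for k \<sigma>
  proof unfold_locales
    show "X t k \<in> borel_measurable M" if "1 \<le> t" for t using assms(3) that k by blast
    show "AE w in M. 0 \<le> X t k w \<and> X t k w \<le> 1" if "1 \<le> t" for t using assms(4) that k by blast
    show "\<mu> k = expectation (X 1 k)" by (simp add: \<mu>_def loss_mean_def)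
    show "expectation (\<lambda>x. (X 1 k x - \<mu> k)\<^sup>2) \<le> v" using var[OF k] by (simp add: loss_var_def \<mu>_def)
    show "distr M borel (X t k) = distr M borel (X 1 k)" if "1 \<le> t" for t using that by (rule id)
  qed (use \<sigma> \<Delta>0 \<Delta>1 in auto)
  have main: "expectation (ftl_regret K X T) \<le> 2 + (ln (real K) + 2) / c"
    if c: "0 < c" "c \<le> 1"
      and tail: "\<And>k t \<sigma>. k < K \<Longrightarrow> 1 \<le> t \<Longrightarrow> \<sigma> = 1 \<or> \<sigma> = - 1 \<Longrightarrow>
        prob {w\<in>space M. real t * (\<Delta> / 2) \<le> \<sigma> * ((\<Sum>s\<in>{1..t}. X s k w) - real t * \<mu> k)} \<le> exp (- c * real t)" for c
  proof (rule expected_ftl_regret_le[where \<epsilon> = "\<Delta> / 2" and \<mu> = \<mu> and K = K and kstar = kstar])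
    show "X t k \<in> borel_measurable M" if "1 \<le> t" "k < K" for t k using assms(3) that by blast
    show "AE w in M. 0 \<le> X t k w \<and> X t k w \<le> 1" if "1 \<le> t" "k < K" for t k using assms(4) that by blast
    show "AE w in M. \<forall>t\<ge>2. card (ftl_set K X t w) = 1" by (rule assms(8))
    show "prob {w\<in>space M. real t * (\<Delta> / 2) \<le> \<sigma> * ((\<Sum>s\<in>{1..t}. X s k w) - real t * \<mu> k)} \<le> exp (- c * real t)"
      if "k < K" "1 \<le> t" "\<sigma> = 1 \<or> \<sigma> = - 1" for k t \<sigma> using that by (rule tail)
    show "2 * (\<Delta> / 2) \<le> \<mu> k - \<mu> kstar" if "k < K" "k \<noteq> kstar" for k using gap[OF that] by simp
  qed (use K assms(5,9) c in auto)
  have \<Delta>2: "\<Delta>\<^sup>2 \<le> \<Delta>" "0 < \<Delta>\<^sup>2" "\<Delta>\<^sup>2 \<le> 1"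
  proof -
    show "\<Delta>\<^sup>2 \<le> \<Delta>" using \<Delta>0 \<Delta>1 mult_left_mono[of \<Delta> 1 \<Delta>] by (simp add: power2_eq_square)
    with \<Delta>1 show "\<Delta>\<^sup>2 \<le> 1" by linarith
  qed (use \<Delta>0 in simp)
  have iid: "expectation (ftl_regret K X T) \<le> 2 + (2 * ln (real K) + 4) / \<Delta>\<^sup>2"
    "expectation (ftl_regret K X T) \<le> 2 + (8 * v + 4 / 3 * \<Delta>) * (ln (2 * real K) + 2) / \<Delta>\<^sup>2"
    if "\<forall>k<K. iid_seq M (\<lambda>t. X t k)"
  proof -
    have indep: "indep_vars (\<lambda>_. borel) (\<lambda>t. X t k) {1..}"
      and id: "1 \<le> t \<Longrightarrow> distr M borel (X t k) = distr M borel (X 1 k)" if "k < K" for k t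
      using \<open>\<forall>k<K. iid_seq M (\<lambda>t. X t k)\<close> that unfolding iid_seq_def by blast+
    have "expectation (ftl_regret K X T) \<le> 2 + (ln (real K) + 2) / (\<Delta>\<^sup>2 / 2)"
    proof (rule main)
      fix k t :: nat and \<sigma> :: real assume k: "k < K" and t: "1 \<le> t" and \<sigma>: "\<sigma> = 1 \<or> \<sigma> = - 1"
      interpret unit_interval_process M "\<lambda>t. X t k" "\<mu> k" v \<sigma> "\<Delta> / 2" by (rule process[OF k \<sigma> id[OF k]])
      show "prob {w\<in>space M. real t * (\<Delta> / 2) \<le> \<sigma> * ((\<Sum>s\<in>{1..t}. X s k w) - real t * \<mu> k)}
          \<le> exp (- (\<Delta>\<^sup>2 / 2) * real t)"
        using iid_hoeffding_tail[OF indep[OF k] t] by (simp add: power_divide)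
    qed (use \<Delta>2 in auto)
    then show "expectation (ftl_regret K X T) \<le> 2 + (2 * ln (real K) + 4) / \<Delta>\<^sup>2"
      by (simp add: field_simps)
    define D where "D = 8 * v + 4 / 3 * \<Delta>"
    \<comment> \<open>With \<Delta>^2 \<le> \<Delta> this makes the rate \<Delta>^2 / D at most
      1.\<close>
    have D: "0 < D" "\<Delta> \<le> D" using \<Delta>0 v0 by (auto simp: D_def)
    have "expectation (ftl_regret K X T) \<le> 2 + (ln (real K) + 2) / (\<Delta>\<^sup>2 / D)"
    proof (rule main)
      fix k t :: nat and \<sigma> :: real assume k: "k < K" and t: "1 \<le> t" and \<sigma>: "\<sigma> = 1 \<or> \<sigma> = - 1"
      interpret unit_interval_process M "\<lambda>t. X t k" "\<mu> k" v \<sigma> "\<Delta> / 2" by (rule process[OF k \<sigma> id[OF k]])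
      have "(\<Delta> / 2)\<^sup>2 / (2 * v + 2 / 3 * (\<Delta> / 2)) = \<Delta>\<^sup>2 / D"
        by (simp add: D_def power_divide)
      then show "prob {w\<in>space M. real t * (\<Delta> / 2) \<le> \<sigma> * ((\<Sum>s\<in>{1..t}. X s k w) - real t * \<mu> k)}
          \<le> exp (- (\<Delta>\<^sup>2 / D) * real t)"
        using iid_bernstein_tail[OF indep[OF k], of t] by simp
    qed (use \<Delta>2 D in auto)
    also have "\<dots> = 2 + D * (ln (real K) + 2) / \<Delta>\<^sup>2" by simp
    also have "\<dots> \<le> 2 + D * (ln (2 * real K) + 2) / \<Delta>\<^sup>2"
      using D K by (intro add_left_mono divide_right_mono mult_left_mono) auto
    finally show "expectation (ftl_regret K X T) \<le> 2 + (8 * v + 4 / 3 * \<Delta>) * (ln (2 * real K) + 2) / \<Delta>\<^sup>2"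
      by (simp add: D_def)
  qed
  have mix: "expectation (ftl_regret K X T) \<le> 3 + 8 * thetaH_max M X K * (ln (real K) + 4) / \<Delta>\<^sup>2"
    "expectation (ftl_regret K X T) \<le> 2 + 8 * thetaB_max M X K * (8 * v + \<Delta>) * (ln (real K) + 2) / \<Delta>\<^sup>2"
    if st: "\<forall>k<K. strictly_stationary M (\<lambda>t. X t k) \<and> phi_mixing M (\<lambda>t. X t k)"
      and su: "\<forall>k<K. summable (\<lambda>n. sqrt (phi_mix_coeff M (\<lambda>t. X t k) (Suc n)))"
  proof -
    define \<phi> where "\<phi> k n = phi_mix_coeff M (\<lambda>t. X t k) n" for k n
    have id: "distr M borel (X t k) = distr M borel (X 1 k)" if k: "k < K" and t: "1 \<le> t" for k t
    proof (rule strictly_stationary_ident_distr[where U = "\<lambda>t. X t k", OF _ _ t])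
      show "strictly_stationary M (\<lambda>t. X t k)" using st k by blast
      show "X t k \<in> borel_measurable M" if "1 \<le> t" for t using assms(3) that k by blast
    qed
    have \<phi>: "0 \<le> \<phi> k n" "\<phi> k n \<le> 1" if k: "k < K" for k n
    proof -
      interpret unit_interval_process M "\<lambda>t. X t k" "\<mu> k" v 1 "\<Delta> / 2" by (rule process[OF k _ id[OF k]]) simp
      show "0 \<le> \<phi> k n" "\<phi> k n \<le> 1" unfolding \<phi>_def by (rule phi_nonneg phi_le_1)+
    qed
    define R where "R k = (\<Sum>n. sqrt (\<phi> k (Suc n)))" for k
    have sR: "(\<Sum>n\<in>{1..m}. sqrt (\<phi> k n)) \<le> R k" if k: "k < K" for k m
    proof -
      have "(\<Sum>n\<in>{1..m}. sqrt (\<phi> k n)) = (\<Sum>n<m. sqrt (\<phi> k (Suc n)))" by (simp add: sum.atLeast1_atMost_eq)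
      also have "\<dots> \<le> R k" unfolding R_def
        using su \<phi>[OF k] k by (intro sum_le_suminf) (auto simp: \<phi>_def)
      finally show ?thesis .
    qed
    \<comment> \<open>Since \<phi> \<le> 1, summability of the square roots also bounds the sums in
      \<open>thetaH_max\<close>, so that its supremum is a genuine one.\<close>
    have sq: "\<phi> k n \<le> sqrt (\<phi> k n)" if k: "k < K" for k n
    proof (rule real_le_rsqrt)
      show "(\<phi> k n)\<^sup>2 \<le> \<phi> k n" using \<phi>[OF k, of n] mult_left_mono[of "\<phi> k n" 1 "\<phi> k n"] by (simp add: power2_eq_square)
    qed
    have thH: "1 + 4 * (\<Sum>n\<in>{1..m}. \<phi> k n) \<le> thetaH_max M X K" if k: "k < K" for k m
    proof -
      have "bdd_above ((\<lambda>t. 1 + 4 * (\<Sum>n\<in>{1..<t}. \<phi> k n)) ` {1..})"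
      proof (rule bdd_aboveI2)
        fix t
        have "(\<Sum>n\<in>{1..<t}. \<phi> k n) \<le> (\<Sum>n\<in>{1..t}. \<phi> k n)" using \<phi>[OF k] by (intro sum_mono2) auto
        also have "\<dots> \<le> (\<Sum>n\<in>{1..t}. sqrt (\<phi> k n))" using sq[OF k] by (rule sum_mono)
        also have "\<dots> \<le> R k" by (rule sR[OF k])
        finally show "1 + 4 * (\<Sum>n\<in>{1..<t}. \<phi> k n) \<le> 1 + 4 * R k" by simp
      qed
      then have "1 + 4 * (\<Sum>n\<in>{1..<Suc m}. \<phi> k n) \<le> (SUP t\<in>{1..}. 1 + 4 * (\<Sum>n\<in>{1..<t}. \<phi> k n))"
        by (rule cSUP_upper[rotated]) simp
      also have "\<dots> \<le> thetaH_max M X K" unfolding thetaH_max_def \<phi>_def using k by (intro Max_ge) auto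
      finally show ?thesis by (simp add: atLeastLessThanSuc_atLeastAtMost)
    qed
    have thB: "(1 + (\<Sum>n\<in>{1..m}. sqrt (\<phi> k n)))\<^sup>2 \<le> thetaB_max M X K" if k: "k < K" for k m
    proof -
      let ?f = "\<lambda>t. (1 + (\<Sum>n\<in>{1..t}. sqrt (\<phi> k n)))\<^sup>2"
      have nn: "0 \<le> (\<Sum>n\<in>{1..t}. sqrt (\<phi> k n))" for t using \<phi>[OF k] by (intro sum_nonneg) auto
      have "bdd_above (?f ` {1..})"
      proof (rule bdd_aboveI2)
        fix t show "?f t \<le> (1 + R k)\<^sup>2" using sR[OF k, of t] nn[of t] by (intro power_mono) auto
      qed
      \<comment> \<open>The supremum runs over t \<ge> 1 while m may be 0, so the index is shifted
        by one; m = 0 later gives \<eta> \<ge> 1.\<close>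
      then have "?f (Suc m) \<le> (SUP t\<in>{1..}. ?f t)" by (rule cSUP_upper[rotated]) simp
      also have "\<dots> \<le> thetaB_max M X K" unfolding thetaB_max_def \<phi>_def using k by (intro Max_ge) auto
      finally have "?f (Suc m) \<le> thetaB_max M X K" .
      moreover have "?f m \<le> ?f (Suc m)" using nn[of m] \<phi>[OF k] by (intro power_mono) auto
      ultimately show ?thesis by linarith
    qed
    define \<theta> where "\<theta> = thetaH_max M X K"
    have \<theta>1: "1 \<le> \<theta>" using thH[OF assms(5), of 0] by (simp add: \<theta>_def)
    have "expectation (ftl_regret K X T) \<le> 2 + (ln (real K) + 2) / (\<Delta>\<^sup>2 / (8 * \<theta>))"
    proof (rule main)
      fix k t :: nat and \<sigma> :: real assume k: "k < K" and t: "1 \<le> t" and \<sigma>: "\<sigma> = 1 \<or> \<sigma> = - 1"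
      interpret unit_interval_process M "\<lambda>t. X t k" "\<mu> k" v \<sigma> "\<Delta> / 2" by (rule process[OF k \<sigma> id[OF k]])
      \<comment> \<open>Phi is read off from the common \<theta> of all experts by solving \<theta>
        = 1 + 4 Phi; in the Bernstein case Psi = sqrt \<eta> - 1 arises in the same way.\<close>
      have "(\<Sum>n\<in>{1..m}. phi_mix_coeff M (\<lambda>t. X t k) n) \<le> (\<theta> - 1) / 4" for m
        using thH[OF k, of m] by (simp add: \<theta>_def \<phi>_def)
      moreover have "(\<theta> :: real) = 1 + 4 * ((\<theta> - 1) / 4)" by (simp add: field_simps)
      ultimately have "prob {w\<in>space M. real t * (\<Delta> / 2) \<le> \<sigma> * ((\<Sum>s\<in>{1..t}. X s k w) - real t * \<mu> k)}
          \<le> exp (- ((\<Delta> / 2)\<^sup>2 / (2 * \<theta>)) * real t)" by (rule mixing_hoeffding_tail)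
      then show "prob {w\<in>space M. real t * (\<Delta> / 2) \<le> \<sigma> * ((\<Sum>s\<in>{1..t}. X s k w) - real t * \<mu> k)}
          \<le> exp (- (\<Delta>\<^sup>2 / (8 * \<theta>)) * real t)"
        by (simp add: power_divide)
    qed (use \<Delta>2 \<theta>1 in auto)
    also have "\<dots> = 2 + 8 * \<theta> * (ln (real K) + 2) / \<Delta>\<^sup>2" by simp
    also have "\<dots> \<le> 3 + 8 * \<theta> * (ln (real K) + 4) / \<Delta>\<^sup>2"
      using \<theta>1 by (intro add_mono divide_right_mono mult_left_mono) auto
    finally show "expectation (ftl_regret K X T) \<le> 3 + 8 * thetaH_max M X K * (ln (real K) + 4) / \<Delta>\<^sup>2"
      by (simp add: \<theta>_def)
    define \<eta> where "\<eta> = thetaB_max M X K"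
    have \<eta>1: "1 \<le> \<eta>" using thB[OF assms(5), of 0] by (simp add: \<eta>_def)
    define D where "D = 8 * \<eta> * (8 * v + \<Delta>)"
    have D: "\<Delta> \<le> D"
    proof -
      have "1 * \<Delta> \<le> (8 * \<eta>) * (8 * v + \<Delta>)" using \<eta>1 v0 \<Delta>0 by (intro mult_mono) auto
      then show ?thesis by (simp add: D_def)
    qed
    have "expectation (ftl_regret K X T) \<le> 2 + (ln (real K) + 2) / (\<Delta>\<^sup>2 / D)"
    proof (rule main)
      fix k t :: nat and \<sigma> :: real assume k: "k < K" and t: "1 \<le> t" and \<sigma>: "\<sigma> = 1 \<or> \<sigma> = - 1"
      interpret unit_interval_process M "\<lambda>t. X t k" "\<mu> k" v \<sigma> "\<Delta> / 2" by (rule process[OF k \<sigma> id[OF k]])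
      have Psi: "(\<Sum>n\<in>{1..m}. sqrt (phi_mix_coeff M (\<lambda>t. X t k) n)) \<le> sqrt \<eta> - 1" for m
        using real_le_rsqrt[OF thB[OF k, of m]] by (simp add: \<eta>_def \<phi>_def)
      have \<eta>: "\<eta> = (1 + (sqrt \<eta> - 1))\<^sup>2" using \<eta>1 by simp
      have "(\<Delta> / 2)\<^sup>2 / (16 * \<eta> * v + 4 * \<eta> * (\<Delta> / 2)) = \<Delta>\<^sup>2 / D"
        by (simp add: D_def power_divide algebra_simps)
      then show "prob {w\<in>space M. real t * (\<Delta> / 2) \<le> \<sigma> * ((\<Sum>s\<in>{1..t}. X s k w) - real t * \<mu> k)}
          \<le> exp (- (\<Delta>\<^sup>2 / D) * real t)"
        using mixing_bernstein_tail[OF Psi \<eta>, of t] by simp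
    qed (use \<Delta>2 D \<Delta>0 in auto)
    then show "expectation (ftl_regret K X T) \<le> 2 + 8 * thetaB_max M X K * (8 * v + \<Delta>) * (ln (real K) + 2) / \<Delta>\<^sup>2"
      by (simp add: D_def \<eta>_def mult_ac)
  qed
  show ?thesis unfolding \<Delta>_def[symmetric] v_def[symmetric]
  proof (intro conjI impI min.boundedI, goal_cases)
    case 1 then show ?case by (rule iid(1))
  next
    case 2 then show ?case by (rule iid(2))
  next
    case 3 then show ?case by (intro mix(1)) blast+
  next
    case 4 then show ?case by (intro mix(2)) blast+
  qed
qed

end
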